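(* Let $\gamma_t=(p_t,\tau_t^2,\sigma_t^2,\delta_{0t},\delta_{At})$, $t=1,2,\dots$, be a sequence of parameter vectors such that, with $u=\tau^2/\sigma^2$, $f=(1-p)/p$, $\delta=\delta_0/\delta_A$ and $v=uf^2\delta^2$ (index $t$ suppressed), one has as $t\to\infty$: $p\to 0$, $u\to\infty$, $v\to\infty$ and $\frac{\log v}{u}\to C\in(0,\infty)$. Consider the fixed threshold rule with $\mathrm{BFDR}=\alpha=\alpha_t\in(0,1-p_t)$, i.e. the rule rejecting $H_{0i}$ iff $X_i^2/\sigma^2\ge c_B^2$, where $c_B>0$ is determined by $\mathrm{BFDR}=\alpha_t$. Put $r_\alpha=\frac{\alpha}{1-\alpha}$ and define $s_t$ by $$\frac{\log(f\delta\sqrt u)}{\log(f/r_\alpha)}=1+s_t .$$ Then the rule is ABOS if and only if $$s_t\to0\qquad\text{and}\qquad 2s_t\log(f/r_\alpha)-\log\log(f/r_\alpha)\to-\infty .$$ In that case the threshold of the rule is of the form $$c_B^2=2\log\left(\frac{f}{r_\alpha}\right)-\log\left(2\log\left(\frac{f}{r_\alpha}\right)\right)+C_1+o_t,$$ where $C_1=\log\left(\frac{2}{\pi D^2}\right)$ and $D=2(1-\Phi(\sqrt C))$, and the corresponding probability of a type I error is $t_1=D\frac{r_\alpha}{f}(1+o_t)$.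
   Context: Model. Given a number of tests $m\ge 1$ and parameters $p\in(0,1)$, $\sigma^2>0$, $\tau^2>0$, let $(\nu_i,X_i)$, $i=1,\dots,m$, be i.i.d. with $P(\nu_i=1)=p=1-P(\nu_i=0)$, $X_i\mid\nu_i=0\sim N(0,\sigma^2)$ and $X_i\mid\nu_i=1\sim N(0,\sigma^2+\tau^2)$. Only the $X_i$ are observed. The null hypothesis $H_{0i}$ is the event $\nu_i=0$, the alternative $H_{Ai}$ is $\nu_i=1$. A type I error (rejecting a true $H_{0i}$) costs $\delta_0>0$, a type II error (accepting $H_{0i}$ when $H_{Ai}$ holds) costs $\delta_A>0$, and the total loss is the sum over the $m$ tests. The Bayes risk of a multiple testing rule is $R=\delta_0E(V)+\delta_AE(T)$, where $V$ is the number of false rejections and $T$ the number of false acceptances; for a rule applying one fixed threshold in all tests, $R=m((1-p)t_1\delta_0+p\,t_2\delta_A)$ with $t_1,t_2$ the probabilities of type I and type II errors in a single test. Bayes oracle: the rule minimizing $R$; it rejects $H_{0i}$ iff $X_i^2/\sigma^2\ge(1+\frac1u)\left(\log v+\log(1+\frac1u)\right)$, where $u=\tau^2/\sigma^2$, $f=(1-p)/p$, $\delta=\delta_0/\delta_A$, $v=uf^2\delta^2$. Its Bayes risk is denoted $R_{\mathrm{opt}}$. ABOS (asymptotically Bayes optimal under sparsity): a rule with risk $R$ is ABOS for the sequence $\gamma_t$ if $R/R_{\mathrm{opt}}\to1$ as $t\to\infty$. The number of tests $m=m_t$ may vary with $t$. BFDR (Bayesian False Discovery Rate) of a fixed threshold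 rule: $\mathrm{BFDR}=P(H_{0i}\text{ true}\mid H_{0i}\text{ rejected})=\frac{(1-p)t_1}{(1-p)t_1+p(1-t_2)}$. For the rule rejecting iff $X_i^2/\sigma^2\ge c^2$ this decreases continuously from $1-p$ at $c=0$ to $0$ as $c\to\infty$; the threshold $c_B$ with BFDR equal to $\alpha$ solves $\frac{(1-p)(1-\Phi(c_B))}{(1-p)(1-\Phi(c_B))+p(1-\Phi(c_B/\sqrt{u+1}))}=\alpha$. $\Phi$ is the standard normal cumulative distribution function; $o_t$ denotes a term tending to $0$ as $t\to\infty$. *)

theory Defs
  imports "HOL-Probability.Probability"
begin

text \<open>
  The two-groups normal model: \<open>\<nu> i \<omega>\<close> holds iff \<open>\<nu>\<^sub>i = 1\<close>, i.e. iff the alternative \<open>H\<^sub>A\<^sub>i\<close> is true.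
  The parameters \<open>\<sigma>2\<close> and \<open>\<tau>2\<close> are variances, whereas \<^const>\<open>normal_density\<close> expects a standard
  deviation.
\<close>

definition centered_normal :: "real \<Rightarrow> real measure" where
  "centered_normal \<sigma>2 = density lborel (\<lambda>x. ennreal (normal_density 0 (sqrt \<sigma>2) x))"

definition two_groups_model ::
  "'w measure \<Rightarrow> nat \<Rightarrow> real \<Rightarrow> real \<Rightarrow> real \<Rightarrow> (nat \<Rightarrow> 'w \<Rightarrow> bool) \<Rightarrow> (nat \<Rightarrow> 'w \<Rightarrow> real) \<Rightarrow> bool" where
  "two_groups_model M m p \<sigma>2 \<tau>2 \<nu> X \<longleftrightarrow>
     prob_space M \<and>
     prob_space.indep_vars M (\<lambda>_. count_space UNIV \<Otimes>\<^sub>M borel) (\<lambda>i \<omega>. (\<nu> i \<omega>, X i \<omega>)) {1..m} \<and>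
     (\<forall>i\<in>{1..m}.
        \<P>(\<omega> in M. \<nu> i \<omega>) = p \<and>
        (\<forall>B\<in>sets borel. \<P>(\<omega> in M. X i \<omega> \<in> B \<bar> \<not> \<nu> i \<omega>) = measure (centered_normal \<sigma>2) B) \<and>
        (\<forall>B\<in>sets borel. \<P>(\<omega> in M. X i \<omega> \<in> B \<bar> \<nu> i \<omega>) = measure (centered_normal (\<sigma>2 + \<tau>2)) B))"

text \<open>
  A multiple testing rule decides on the basis of all the observations: \<open>\<phi> i x\<close> means that
  \<open>H\<^sub>0\<^sub>i\<close> is rejected when the data are \<open>x = (x\<^sub>1, \<dots>, x\<^sub>m)\<close>.
\<close>

type_synonym testing_rule = "nat \<Rightarrow> (nat \<Rightarrow> real) \<Rightarrow> bool"

definition testing_rules :: "nat \<Rightarrow> testing_rule set" where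
  "testing_rules m =
     {\<phi>. \<forall>i\<in>{1..m}. \<phi> i \<in> measurable (\<Pi>\<^sub>M j\<in>{1..m}. borel) (count_space UNIV)}"

definition observations :: "nat \<Rightarrow> (nat \<Rightarrow> 'w \<Rightarrow> real) \<Rightarrow> 'w \<Rightarrow> nat \<Rightarrow> real" where
  "observations m X \<omega> = (\<lambda>j\<in>{1..m}. X j \<omega>)"

definition false_rejections ::
  "nat \<Rightarrow> (nat \<Rightarrow> 'w \<Rightarrow> bool) \<Rightarrow> (nat \<Rightarrow> 'w \<Rightarrow> real) \<Rightarrow> testing_rule \<Rightarrow> 'w \<Rightarrow> nat" where
  "false_rejections m \<nu> X \<phi> \<omega> = card {i\<in>{1..m}. \<not> \<nu> i \<omega> \<and> \<phi> i (observations m X \<omega>)}"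

definition false_acceptances ::
  "nat \<Rightarrow> (nat \<Rightarrow> 'w \<Rightarrow> bool) \<Rightarrow> (nat \<Rightarrow> 'w \<Rightarrow> real) \<Rightarrow> testing_rule \<Rightarrow> 'w \<Rightarrow> nat" where
  "false_acceptances m \<nu> X \<phi> \<omega> = card {i\<in>{1..m}. \<nu> i \<omega> \<and> \<not> \<phi> i (observations m X \<omega>)}"

definition bayes_risk ::
  "'w measure \<Rightarrow> nat \<Rightarrow> real \<Rightarrow> real \<Rightarrow> (nat \<Rightarrow> 'w \<Rightarrow> bool) \<Rightarrow> (nat \<Rightarrow> 'w \<Rightarrow> real) \<Rightarrow> testing_rule \<Rightarrow> real" where
  "bayes_risk M m \<delta>0 \<delta>A \<nu> X \<phi> =
     \<delta>0 * (\<integral>\<omega>. real (false_rejections m \<nu> X \<phi> \<omega>) \<partial>M) +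
     \<delta>A * (\<integral>\<omega>. real (false_acceptances m \<nu> X \<phi> \<omega>) \<partial>M)"

text \<open>
  The risk of the Bayes oracle. The infimum over all multiple testing rules is attained by
  the rule that rejects \<open>H\<^sub>0\<^sub>i\<close> iff
  \<open>X\<^sub>i\<^sup>2 / \<sigma>\<^sup>2 \<ge> (1 + 1/u) * (ln v + ln (1 + 1/u))\<close>, where \<open>u = \<tau>\<^sup>2 / \<sigma>\<^sup>2\<close> and
  \<open>v = u * ((1 - p) / p)\<^sup>2 * (\<delta>\<^sub>0 / \<delta>\<^sub>A)\<^sup>2\<close>.
\<close>

definition optimal_risk ::
  "'w measure \<Rightarrow> nat \<Rightarrow> real \<Rightarrow> real \<Rightarrow> (nat \<Rightarrow> 'w \<Rightarrow> bool) \<Rightarrow> (nat \<Rightarrow> 'w \<Rightarrow> real) \<Rightarrow> real" where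
  "optimal_risk M m \<delta>0 \<delta>A \<nu> X = (INF \<phi>\<in>testing_rules m. bayes_risk M m \<delta>0 \<delta>A \<nu> X \<phi>)"

definition ABOS ::
  "(nat \<Rightarrow> 'w measure) \<Rightarrow> (nat \<Rightarrow> nat) \<Rightarrow> (nat \<Rightarrow> real) \<Rightarrow> (nat \<Rightarrow> real) \<Rightarrow>
   (nat \<Rightarrow> nat \<Rightarrow> 'w \<Rightarrow> bool) \<Rightarrow> (nat \<Rightarrow> nat \<Rightarrow> 'w \<Rightarrow> real) \<Rightarrow> (nat \<Rightarrow> testing_rule) \<Rightarrow> bool" where
  "ABOS M m \<delta>0 \<delta>A \<nu> X \<phi> \<longleftrightarrow>
     (\<lambda>t. bayes_risk (M t) (m t) (\<delta>0 t) (\<delta>A t) (\<nu> t) (X t) (\<phi> t) /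
          optimal_risk (M t) (m t) (\<delta>0 t) (\<delta>A t) (\<nu> t) (X t)) \<longlonglongrightarrow> 1"

definition type1_error_prob ::
  "'w measure \<Rightarrow> nat \<Rightarrow> (nat \<Rightarrow> 'w \<Rightarrow> bool) \<Rightarrow> (nat \<Rightarrow> 'w \<Rightarrow> real) \<Rightarrow> testing_rule \<Rightarrow> nat \<Rightarrow> real" where
  "type1_error_prob M m \<nu> X \<phi> i = \<P>(\<omega> in M. \<phi> i (observations m X \<omega>) \<bar> \<not> \<nu> i \<omega>)"

definition BFDR ::
  "'w measure \<Rightarrow> nat \<Rightarrow> (nat \<Rightarrow> 'w \<Rightarrow> bool) \<Rightarrow> (nat \<Rightarrow> 'w \<Rightarrow> real) \<Rightarrow> testing_rule \<Rightarrow> nat \<Rightarrow> real" where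
  "BFDR M m \<nu> X \<phi> i = \<P>(\<omega> in M. \<not> \<nu> i \<omega> \<bar> \<phi> i (observations m X \<omega>))"

definition fixed_threshold_rule :: "real \<Rightarrow> real \<Rightarrow> testing_rule" where
  "fixed_threshold_rule \<sigma>2 c = (\<lambda>i x. (x i)\<^sup>2 / \<sigma>2 \<ge> c\<^sup>2)"

definition std_normal_cdf :: "real \<Rightarrow> real" where
  "std_normal_cdf = cdf std_normal_distribution"

end

theory Submission
  imports Defs "HOL-Real_Asymp.Real_Asymp"
begin

text \<open>
  Write \<open>Q x = 2 * (1 - \<Phi> x)\<close> for the two-sided normal tail, \<open>y = c\<^sub>B / sqrt (1 + u)\<close>, and
  \<open>L = ln (f / r)\<close>. A rule with threshold \<open>c\<close> has type I error probability \<open>Q c\<close> and power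
  \<open>Q (c / sqrt (1 + u))\<close> in every test, so its risk, divided by \<open>m * p * \<delta>A\<close>, is
  \<open>f * \<delta> * Q c + (1 - Q (c / sqrt (1 + u)))\<close>, and the condition \<open>BFDR = \<alpha>\<close> reads \<open>f * Q c\<^sub>B = r * Q y\<close>,
  that is, \<open>ln (Q y) - ln (Q c\<^sub>B) = L\<close>.

  The optimal risk, with the same normalisation, tends to \<open>1 - D = P(\<bar>Z\<bar> \<le> sqrt C)\<close> for a standard
  normal \<open>Z\<close>. No exact form of the Bayes oracle is needed for this, since the threshold
  \<open>c\<^sup>2 = ln v\<close> is accurate enough. Where \<open>x\<^sup>2 / \<sigma>2 < ln v\<close>, the weighted null density
  \<open>\<delta>0 * (1 - p) * f\<^sub>0 x\<close> is at least the weighted alternative density \<open>\<delta>A * p * f\<^sub>A x\<close>. By independence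
  and Fubini, no testing rule (whatever use it makes of the other observations) can therefore
  lose less in one test than \<open>\<delta>A * p * P\<^sub>A(X\<^sup>2 / \<sigma>2 < ln v)\<close>
  (\<open>single_test_risk_ge\<close>, \<open>optimal_risk_bounds\<close>). The rule with threshold \<open>c\<^sup>2 = ln v\<close> itself adds
  to this lower bound a type I term that is \<open>O(1 / sqrt u)\<close> (\<open>oracle_risk_bounds_lim\<close>).

  Hence the rule is ABOS iff its normalised risk tends to \<open>1 - D\<close>, and this happens iff
  \<open>y \<rightarrow> sqrt C\<close> and \<open>f * \<delta> * Q c\<^sub>B \<rightarrow> 0\<close>: a limit point of \<open>y\<close> above \<open>sqrt C\<close> makes the type II term
  too large, and one below \<open>sqrt C\<close> makes the type I term explode. From
  \<open>x\<^sup>2 / 2 - 1 / 2 \<le> - ln (Q x) \<le> x\<^sup>2 / 2 + x + 1\<close> and the BFDR equation, \<open>y \<rightarrow> sqrt C\<close> is equivalent to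
  \<open>s \<rightarrow> 0\<close> (\<open>y_lim_imp\<close>, \<open>y_lim_if_s_lim\<close>). In that case \<open>u / L\<close> and \<open>Q y\<close> have positive
  limits, and the identity
  \<open>2 * ln (f * \<delta> * Q c\<^sub>B) = 2 * s * L - ln L + 2 * ln (Q y) - ln (u / L)\<close> (\<open>ln_type1_term\<close>)
  turns \<open>f * \<delta> * Q c\<^sub>B \<rightarrow> 0\<close> into the second condition of the theorem. The expansion of \<open>c\<^sub>B\<^sup>2\<close> results from the
  BFDR equation and the Mills ratio \<open>Q x \<sim> sqrt (2 / pi) * exp (- x\<^sup>2 / 2) / x\<close>, and that of the type I error
  probability from \<open>Q c\<^sub>B = Q y * r / f\<close> and \<open>Q y \<rightarrow> D\<close>.
\<close>

section \<open>The two-sided tail of the standard normal distribution\<close>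

text \<open>The probability that a standard normal variable exceeds \<open>x\<close> in absolute value, for \<open>x \<ge> 0\<close>.\<close>

definition normal_tail :: "real \<Rightarrow> real" where
  "normal_tail x = 2 * (1 - std_normal_cdf x)"

interpretation std_normal: real_distribution std_normal_distribution
  by (rule real_dist_normal_dist)

lemma emeasure_std_normal:
  assumes "B \<in> sets borel"
  shows "emeasure std_normal_distribution B =
    (\<integral>\<^sup>+z. ennreal (std_normal_density z) * indicator B z \<partial>lborel)"
  using assms by (subst emeasure_density) auto

lemma measure_std_normal_singleton: "measure std_normal_distribution {x} = 0"
proof -
  have "emeasure std_normal_distribution {x} = 0"
    by (simp add: emeasure_std_normal nn_integral_null_set)
  then show ?thesis
    by (simp add: measure_def)
qed

lemma std_normal_cdf_eq: "std_normal_cdf x = measure std_normal_distribution {..x}"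
  by (simp add: std_normal_cdf_def cdf_def)

lemma measure_std_normal_atLeast:
  "measure std_normal_distribution {x..} = 1 - std_normal_cdf x"
proof -
  have "measure std_normal_distribution {x..} = measure std_normal_distribution ({x<..} \<union> {x})"
    by (rule arg_cong[where f="measure _"]) auto
  also have "\<dots> = measure std_normal_distribution {x<..}"
    by (subst std_normal.finite_measure_Union) (auto simp: measure_std_normal_singleton)
  also have "{x<..} = space std_normal_distribution - {..x}"
    by auto
  also have "measure std_normal_distribution \<dots> = 1 - std_normal_cdf x"
    by (subst std_normal.prob_compl) (auto simp: std_normal_cdf_eq)
  finally show ?thesis .
qed

lemma measure_std_normal_atMost_uminus:
  "measure std_normal_distribution {..-x} = measure std_normal_distribution {x..}"
proof -
  have "distributed std_normal_distribution lborel (\<lambda>z. z) std_normal_density"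
    by (simp add: distributed_def distr_id2)
  from std_normal.normal_density_affine[OF this, of "-1" 0]
  have "distributed std_normal_distribution lborel uminus std_normal_density"
    by simp
  then have "std_normal_distribution = distr std_normal_distribution lborel uminus"
    by (simp add: distributed_def)
  then have "measure std_normal_distribution {..-x} =
      measure (distr std_normal_distribution lborel uminus) {..-x}"
    by simp
  also have "\<dots> = measure std_normal_distribution (uminus -` {..-x} \<inter> space std_normal_distribution)"
    by (rule measure_distr) auto
  also have "uminus -` {..-x} \<inter> space std_normal_distribution = {x..}"
    by auto
  finally show ?thesis .
qed

lemma measure_std_normal_abs_ge:
  assumes "0 < x"
  shows "measure std_normal_distribution {z. x \<le> \<bar>z\<bar>} = normal_tail x"
proof -
  have "{z. x \<le> \<bar>z\<bar>} = {..-x} \<union> {x..}"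
    using assms by auto
  then have "measure std_normal_distribution {z. x \<le> \<bar>z\<bar>} =
      measure std_normal_distribution {..-x} + measure std_normal_distribution {x..}"
    using assms by (simp only:, subst std_normal.finite_measure_Union) auto
  then show ?thesis
    by (simp add: measure_std_normal_atMost_uminus measure_std_normal_atLeast normal_tail_def)
qed

lemma normal_tail_diff_ge:
  assumes "0 \<le> a" "a \<le> b"
  shows "2 * (b - a) * std_normal_density b \<le> normal_tail a - normal_tail b"
proof -
  have *: "std_normal_density b \<le> std_normal_density z" if "z \<in> {a<..b}" for z
    using that assms power_mono[of z b 2] by (auto simp: std_normal_density_def intro!: divide_right_mono)
  have "ennreal (std_normal_density b) * ennreal (b - a) =
      (\<integral>\<^sup>+z. ennreal (std_normal_density b) * indicator {a<..b} z \<partial>lborel)"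
    using assms by (simp add: nn_integral_cmult_indicator)
  also have "\<dots> \<le> emeasure std_normal_distribution {a<..b}"
    unfolding emeasure_std_normal[of "{a<..b}", simplified]
    by (intro nn_integral_mono) (auto split: split_indicator intro: ennreal_leI *)
  finally have "std_normal_density b * (b - a) \<le> measure std_normal_distribution {a<..b}"
    using assms
    by (simp add: std_normal.emeasure_eq_measure ennreal_mult[symmetric] ennreal_le_iff)
  also have "\<dots> = std_normal_cdf b - std_normal_cdf a"
  proof (cases "a < b")
    case True
    then show ?thesis
      using std_normal.cdf_diff_eq[of a b] by (simp add: std_normal_cdf_def)
  qed (use assms in simp)
  finally show ?thesis
    by (simp add: normal_tail_def algebra_simps)
qed

lemma normal_tail_strict_antimono:
  assumes "0 \<le> a" "a < b"
  shows "normal_tail b < normal_tail a"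
proof -
  have "0 < 2 * (b - a) * std_normal_density b"
    using assms by (intro mult_pos_pos normal_density_pos) auto
  then show ?thesis
    using normal_tail_diff_ge[of a b] assms by linarith
qed

lemma normal_tail_antimono: "a \<le> b \<Longrightarrow> normal_tail b \<le> normal_tail a"
  using std_normal.cdf_nondecreasing[of a b] by (simp add: normal_tail_def std_normal_cdf_def)

lemma normal_tail_nonneg: "0 \<le> normal_tail x"
  using std_normal.cdf_bounded_prob[of x] by (simp add: normal_tail_def std_normal_cdf_def)

lemma normal_tail_pos: "0 \<le> x \<Longrightarrow> 0 < normal_tail x"
  using normal_tail_strict_antimono[of x "x + 1"] normal_tail_nonneg[of "x + 1"] by simp

lemma isCont_normal_tail: "isCont normal_tail x"
proof -
  have "isCont std_normal_cdf x"
    unfolding std_normal_cdf_def std_normal.isCont_cdf by (rule measure_std_normal_singleton)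
  then show ?thesis
    unfolding normal_tail_def[abs_def] by (intro continuous_intros)
qed

lemma normal_tail_0: "normal_tail 0 = 1"
proof -
  have "measure std_normal_distribution {0..} = std_normal_cdf 0"
    using measure_std_normal_atMost_uminus[of 0] by (simp add: std_normal_cdf_eq)
  then show ?thesis
    using measure_std_normal_atLeast[of 0] by (simp add: normal_tail_def)
qed

lemma normal_tail_le_1: "0 \<le> x \<Longrightarrow> normal_tail x \<le> 1"
  using normal_tail_antimono[of 0 x] by (simp add: normal_tail_0)

lemma normal_tail_less_1: "0 < x \<Longrightarrow> normal_tail x < 1"
  using normal_tail_strict_antimono[of 0 x] by (simp add: normal_tail_0)

lemma has_derivative_std_normal_density:
  "(std_normal_density has_real_derivative - z * std_normal_density z) (at z)"
  unfolding std_normal_density_def[abs_def] by (auto intro!: derivative_eq_intros simp: field_simps)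

lemma std_normal_density_tendsto_0: "(std_normal_density \<longlongrightarrow> 0) at_top"
  unfolding std_normal_density_def[abs_def] by real_asymp

text \<open>
  The Mills ratio bounds: integrate \<open>\<phi> z \<le> (z / x) * \<phi> z\<close> and
  \<open>(1 + 1 / z\<^sup>2) * \<phi> z \<le> (1 + 1 / x\<^sup>2) * \<phi> z\<close> over \<open>z \<ge> x\<close>, where \<open>\<phi>\<close> is the density; the functions
  \<open>z * \<phi> z\<close> and \<open>(1 + 1 / z\<^sup>2) * \<phi> z\<close> have the antiderivatives \<open>- \<phi> z\<close> and \<open>- \<phi> z / z\<close>.
\<close>

lemma normal_tail_Mills:
  assumes "0 < x"
  shows "normal_tail x \<le> 2 * std_normal_density x / x"
    and "2 * std_normal_density x / x \<le> (1 + 1 / x\<^sup>2) * normal_tail x"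
proof -
  have tail: "(\<integral>\<^sup>+z. ennreal (std_normal_density z) * indicator {x..} z \<partial>lborel) =
      ennreal (normal_tail x / 2)"
    using emeasure_std_normal[of "{x..}"] measure_std_normal_atLeast[of x]
    by (simp add: std_normal.emeasure_eq_measure normal_tail_def diff_divide_distrib)
  have "(\<integral>\<^sup>+z. ennreal (std_normal_density z) * indicator {x..} z \<partial>lborel) \<le>
      (\<integral>\<^sup>+z. ennreal (z / x * std_normal_density z) * indicator {x..} z \<partial>lborel)"
    using assms by (intro nn_integral_mono)
      (auto split: split_indicator intro!: ennreal_leI simp: field_simps mult_right_mono)
  also have "\<dots> = ennreal (0 - - std_normal_density x / x)"
    using assms std_normal_density_tendsto_0
    by (intro nn_integral_FTC_atLeast)
       (auto intro!: derivative_eq_intros has_derivative_std_normal_density tendsto_eq_intros)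
  finally show "normal_tail x \<le> 2 * std_normal_density x / x"
    unfolding tail using assms by (subst (asm) ennreal_le_iff) (auto simp: field_simps)
  have "ennreal (std_normal_density x / x) = ennreal (0 - - std_normal_density x / x)"
    by simp
  also have "\<dots> =
      (\<integral>\<^sup>+z. ennreal ((1 + 1 / z\<^sup>2) * std_normal_density z) * indicator {x..} z \<partial>lborel)"
    using assms
  proof (intro nn_integral_FTC_atLeast[symmetric])
    show "((\<lambda>z. - std_normal_density z / z) \<longlongrightarrow> 0) at_top"
      unfolding std_normal_density_def by real_asymp
  qed (auto intro!: derivative_eq_intros has_derivative_std_normal_density
      simp: field_simps power2_eq_square)
  also have "\<dots> \<le> (\<integral>\<^sup>+z. ennreal (1 + 1 / x\<^sup>2) *
      (ennreal (std_normal_density z) * indicator {x..} z) \<partial>lborel)"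
  proof (intro nn_integral_mono)
    fix z :: real
    have "ennreal ((1 + 1 / z\<^sup>2) * std_normal_density z) \<le>
        ennreal (1 + 1 / x\<^sup>2) * ennreal (std_normal_density z)" if "x \<le> z"
      unfolding ennreal_mult''[OF normal_density_nonneg, symmetric] using assms that
      by (intro ennreal_leI mult_right_mono add_left_mono divide_left_mono power_mono) auto
    then show "ennreal ((1 + 1 / z\<^sup>2) * std_normal_density z) * indicator {x..} z \<le>
        ennreal (1 + 1 / x\<^sup>2) * (ennreal (std_normal_density z) * indicator {x..} z)"
      by (simp split: split_indicator)
  qed
  also have "\<dots> = ennreal ((1 + 1 / x\<^sup>2) * (normal_tail x / 2))"
    using normal_tail_nonneg[of x] by (subst nn_integral_cmult) (measurable, simp only: tail, subst ennreal_mult'', simp_all)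
  finally show "2 * std_normal_density x / x \<le> (1 + 1 / x\<^sup>2) * normal_tail x"
    using assms normal_tail_nonneg[of x] by (simp add: ennreal_le_iff mult.commute)
qed

lemma ln_std_normal_density: "ln (2 * std_normal_density x) = - x\<^sup>2 / 2 - ln (pi / 2) / 2"
proof -
  have "2 / sqrt (2 * pi) = sqrt (2 / pi)"
    by (rule real_sqrt_unique[symmetric]) (auto simp: power_divide)
  then have "2 * std_normal_density x = sqrt (2 / pi) * exp (- x\<^sup>2 / 2)"
    by (simp add: std_normal_density_def flip: times_divide_eq_left)
  then show ?thesis
    by (simp add: ln_mult ln_sqrt ln_div field_simps)
qed

text \<open>
  Two crude bounds valid on the whole half-line \<open>x \<ge> 0\<close>. They give the leading term of the logarithm of the
  tail without knowing whether the argument is bounded or tends to infinity.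
\<close>

lemma minus_ln_normal_tail_ge:
  assumes "0 \<le> x"
  shows "(x\<^sup>2 - 1) / 2 \<le> - ln (normal_tail x)"
proof (cases "x \<le> 1")
  case True
  then have "x\<^sup>2 \<le> 1"
    using assms by (simp add: power_le_one)
  moreover have "ln (normal_tail x) \<le> 0"
    using assms normal_tail_le_1[of x] normal_tail_pos[of x] by simp
  ultimately show ?thesis
    by simp
next
  case False
  have "normal_tail x \<le> 2 * std_normal_density x"
    using normal_tail_Mills(1)[of x] False normal_density_nonneg[of 0 1 x]
      mult_left_mono[of 1 x "2 * std_normal_density x"]
    by (simp add: pos_le_divide_eq)
      (smt (verit, best) mult_left_mono normal_tail_nonneg mult_cancel_left1)
  then have "ln (normal_tail x) \<le> ln (2 * std_normal_density x)"
    using normal_tail_pos[of x] False by (intro ln_mono) auto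
  moreover have "0 \<le> ln (pi / 2)"
    using pi_ge_two by (intro ln_ge_zero) auto
  ultimately show ?thesis
    unfolding ln_std_normal_density by (subst diff_divide_distrib) linarith
qed

lemma minus_ln_normal_tail_le:
  assumes "0 \<le> x"
  shows "- ln (normal_tail x) \<le> x\<^sup>2 / 2 + x + 1"
proof -
  have "2 * std_normal_density (x + 1) \<le> normal_tail x"
    using normal_tail_diff_ge[of x "x + 1"] assms normal_tail_nonneg[of "x + 1"] by simp
  moreover have "0 < std_normal_density (x + 1)"
    by (simp add: normal_density_pos)
  ultimately have "ln (2 * std_normal_density (x + 1)) \<le> ln (normal_tail x)"
    by (intro ln_mono) auto
  moreover have "ln (pi / 2) \<le> 1"
  proof -
    have "pi / 2 \<le> exp 1"
      using pi_less_4 exp_ge_add_one_self[of 1] by linarith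
    then show ?thesis
      using ln_mono[of "pi/2" "exp 1"] by simp
  qed
  ultimately show ?thesis
    unfolding ln_std_normal_density by (simp add: power2_sum field_simps)
qed

lemma minus_ln_normal_tail_asymp:
  "((\<lambda>x. - ln (normal_tail x) - x\<^sup>2 / 2 - ln x) \<longlongrightarrow> ln (pi / 2) / 2) at_top"
proof (rule tendsto_sandwich)
  show "\<forall>\<^sub>F x in at_top. ln (pi / 2) / 2 \<le> - ln (normal_tail x) - x\<^sup>2 / 2 - ln x"
    using eventually_gt_at_top[of 0]
  proof eventually_elim
    case (elim x)
    then have "ln (normal_tail x) \<le> ln (2 * std_normal_density x / x)"
      using normal_tail_Mills(1)[of x] normal_tail_pos[of x] by (intro ln_mono) auto
    also have "\<dots> = - x\<^sup>2 / 2 - ln (pi / 2) / 2 - ln x"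
      using elim normal_density_pos[of 1 0 x] by (simp add: ln_div ln_std_normal_density)
    finally show ?case
      by simp
  qed
  show "\<forall>\<^sub>F x in at_top. - ln (normal_tail x) - x\<^sup>2 / 2 - ln x \<le> ln (pi / 2) / 2 + ln (1 + 1 / x\<^sup>2)"
    using eventually_gt_at_top[of 0]
  proof eventually_elim
    case (elim x)
    have "- x\<^sup>2 / 2 - ln (pi / 2) / 2 - ln x = ln (2 * std_normal_density x / x)"
      using elim normal_density_pos[of 1 0 x] by (simp add: ln_div ln_std_normal_density)
    also have "\<dots> \<le> ln ((1 + 1 / x\<^sup>2) * normal_tail x)"
      using normal_tail_Mills(2)[of x] normal_density_pos[of 1 0 x] elim by (intro ln_mono) auto
    also have "\<dots> = ln (1 + 1 / x\<^sup>2) + ln (normal_tail x)"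
      using elim normal_tail_pos[of x] by (subst ln_mult) (auto simp: add_nonneg_eq_0_iff)
    finally show ?case
      by simp
  qed
  show "((\<lambda>x::real. ln (pi / 2) / 2 + ln (1 + 1 / x\<^sup>2)) \<longlongrightarrow> ln (pi / 2) / 2) at_top"
    by real_asymp
qed simp

section \<open>Error probabilities and risks in the two-groups model\<close>

lemma centered_normal_eq_distr:
  assumes "0 < s"
  shows "centered_normal s = distr std_normal_distribution lborel (\<lambda>z. sqrt s * z)"
proof -
  have "distributed std_normal_distribution lborel (\<lambda>z. z) std_normal_density"
    by (simp add: distributed_def distr_id2)
  from std_normal.normal_density_affine[OF this, of "sqrt s" 0]
  show ?thesis
    using assms by (simp add: distributed_def centered_normal_def)
qed

lemma sets_centered_normal [measurable_cong, simp]: "sets (centered_normal s) = sets borel"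
  by (simp add: centered_normal_def)

lemma space_centered_normal [simp]: "space (centered_normal s) = UNIV"
  by (simp add: centered_normal_def)

lemma prob_space_centered_normal: "0 < s \<Longrightarrow> prob_space (centered_normal s)"
  unfolding centered_normal_def by (rule prob_space_normal_density) simp

lemma measure_centered_normal_tail:
  assumes "0 < s" "0 < \<sigma>2" "0 < c"
  shows "measure (centered_normal s) {x. c\<^sup>2 \<le> x\<^sup>2 / \<sigma>2} = normal_tail (c / sqrt (s / \<sigma>2))"
proof -
  let ?a = "c / sqrt (s / \<sigma>2)"
  have "0 < ?a"
    using assms by simp
  have "c\<^sup>2 \<le> (sqrt s * z)\<^sup>2 / \<sigma>2 \<longleftrightarrow> ?a \<le> \<bar>z\<bar>" for z
  proof -
    have "c\<^sup>2 \<le> (sqrt s * z)\<^sup>2 / \<sigma>2 \<longleftrightarrow> ?a\<^sup>2 \<le> \<bar>z\<bar>\<^sup>2"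
      using assms by (simp add: power_mult_distrib power_divide field_simps)
    also have "\<dots> \<longleftrightarrow> ?a \<le> \<bar>z\<bar>"
      using \<open>0 < ?a\<close> by (intro power_mono_iff) auto
    finally show ?thesis .
  qed
  then have "(\<lambda>z. sqrt s * z) -` {x. c\<^sup>2 \<le> x\<^sup>2 / \<sigma>2} \<inter> space std_normal_distribution = {z. ?a \<le> \<bar>z\<bar>}"
    by auto
  then show ?thesis
    using assms measure_std_normal_abs_ge[OF \<open>0 < ?a\<close>]
    by (simp add: centered_normal_eq_distr measure_distr)
qed

lemma measure_centered_normal_below:
  assumes "0 < s" "0 < \<sigma>2" "0 < c"
  shows "measure (centered_normal s) {x. x\<^sup>2 / \<sigma>2 < c\<^sup>2} = 1 - normal_tail (c / sqrt (s / \<sigma>2))"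
proof -
  interpret prob_space "centered_normal s"
    using assms by (intro prob_space_centered_normal)
  have "{x. x\<^sup>2 / \<sigma>2 < c\<^sup>2} = space (centered_normal s) - {x. c\<^sup>2 \<le> x\<^sup>2 / \<sigma>2}"
    by auto
  then have "prob {x. x\<^sup>2 / \<sigma>2 < c\<^sup>2} = 1 - prob {x. c\<^sup>2 \<le> x\<^sup>2 / \<sigma>2}"
    by (simp only:) (rule prob_compl, simp)
  then show ?thesis
    using assms by (simp add: measure_centered_normal_tail)
qed

text \<open>
  On \<open>{x. x\<^sup>2 / \<sigma>2 < ln v}\<close> the null density is at least \<open>1 / sqrt v\<close> times its maximum, and the maximum
  of the alternative density is smaller than that of the null density by the factor
  \<open>sqrt (1 + \<tau>2 / \<sigma>2)\<close>.
\<close>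

lemma centered_normal_mult_le:
  assumes "0 \<le> a" "0 \<le> b" "0 < v" "0 < \<sigma>2" "0 < \<tau>2"
    and ab: "a * sqrt v \<le> b * sqrt (1 + \<tau>2 / \<sigma>2)"
    and B: "B \<in> sets borel" "B \<subseteq> {x. x\<^sup>2 / \<sigma>2 < ln v}"
  shows "a * measure (centered_normal (\<sigma>2 + \<tau>2)) B \<le> b * measure (centered_normal \<sigma>2) B"
proof -
  interpret N0: prob_space "centered_normal \<sigma>2"
    using assms by (intro prob_space_centered_normal)
  interpret NA: prob_space "centered_normal (\<sigma>2 + \<tau>2)"
    using assms by (intro prob_space_centered_normal) auto
  have le: "a * normal_density 0 (sqrt (\<sigma>2 + \<tau>2)) x \<le> b * normal_density 0 (sqrt \<sigma>2) x"
    if "x \<in> B" for x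
  proof -
    have "exp (- ln v / 2) \<le> exp (- x\<^sup>2 / (2 * \<sigma>2))"
      using that B assms by (auto simp: field_simps)
    also have "exp (- ln v / 2) = 1 / sqrt v"
      using assms by (simp add: exp_minus ln_sqrt[symmetric] inverse_eq_divide)
    finally have *: "1 / sqrt v \<le> exp (- x\<^sup>2 / (2 * \<sigma>2))" .
    have "a * normal_density 0 (sqrt (\<sigma>2 + \<tau>2)) x \<le> a * (1 / sqrt (2 * pi * (\<sigma>2 + \<tau>2)))"
      using assms by (intro mult_left_mono) (simp_all add: normal_density_def divide_right_mono)
    also have "\<dots> \<le> b * (1 / sqrt (2 * pi * \<sigma>2)) * (1 / sqrt v)"
    proof -
      have "sqrt (2 * pi * (\<sigma>2 + \<tau>2)) = sqrt (2 * pi * \<sigma>2) * sqrt (1 + \<tau>2 / \<sigma>2)"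
        using assms by (simp add: real_sqrt_mult[symmetric] field_simps)
      moreover have "0 < sqrt (1 + \<tau>2 / \<sigma>2)" "0 < sqrt (2 * pi * \<sigma>2)"
        using assms by (auto intro!: add_pos_pos)
      ultimately show ?thesis
        using ab assms by (simp add: divide_simps)
    qed
    also have "\<dots> \<le> b * (1 / sqrt (2 * pi * \<sigma>2)) * exp (- x\<^sup>2 / (2 * \<sigma>2))"
      using assms by (intro mult_left_mono[OF *]) auto
    also have "\<dots> = b * normal_density 0 (sqrt \<sigma>2) x"
      using assms by (simp add: normal_density_def)
    finally show ?thesis .
  qed
  have "ennreal (a * measure (centered_normal (\<sigma>2 + \<tau>2)) B) =
      (\<integral>\<^sup>+x. ennreal (a * normal_density 0 (sqrt (\<sigma>2 + \<tau>2)) x) * indicator B x \<partial>lborel)"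
    using assms unfolding ennreal_mult'[OF \<open>0 \<le> a\<close>] NA.emeasure_eq_measure[symmetric]
    by (simp add: centered_normal_def emeasure_density nn_integral_cmult[symmetric] ac_simps)
  also have "\<dots> \<le> (\<integral>\<^sup>+x. ennreal (b * normal_density 0 (sqrt \<sigma>2) x) * indicator B x \<partial>lborel)"
    by (intro nn_integral_mono) (auto split: split_indicator intro: ennreal_leI le)
  also have "\<dots> = ennreal (b * measure (centered_normal \<sigma>2) B)"
    using assms unfolding ennreal_mult'[OF \<open>0 \<le> b\<close>] N0.emeasure_eq_measure[symmetric]
    by (simp add: centered_normal_def emeasure_density nn_integral_cmult[symmetric] ac_simps)
  finally show ?thesis
    using assms by (simp add: ennreal_le_iff)
qed

lemma fixed_threshold_rule_in_testing_rules: "fixed_threshold_rule \<sigma>2 c \<in> testing_rules m"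
  unfolding testing_rules_def fixed_threshold_rule_def by auto

text \<open>The two-groups model with non-degenerate parameters, for one fixed parameter vector.\<close>

locale two_groups = prob_space M for M :: "'w measure" +
  fixes m :: nat and p \<sigma>2 \<tau>2 :: real and \<nu> :: "nat \<Rightarrow> 'w \<Rightarrow> bool" and X :: "nat \<Rightarrow> 'w \<Rightarrow> real"
  assumes model: "two_groups_model M m p \<sigma>2 \<tau>2 \<nu> X"
    and p_pos: "0 < p" and p_less_1: "p < 1"
    and \<sigma>2_pos: "0 < \<sigma>2" and \<tau>2_pos: "0 < \<tau>2"
begin

lemma indep: "indep_vars (\<lambda>_. count_space UNIV \<Otimes>\<^sub>M borel) (\<lambda>i \<omega>. (\<nu> i \<omega>, X i \<omega>)) {1..m}"
  using model by (simp add: two_groups_model_def)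

lemma measurable_pair:
  assumes "i \<in> {1..m}"
  shows "(\<lambda>\<omega>. (\<nu> i \<omega>, X i \<omega>)) \<in> M \<rightarrow>\<^sub>M count_space UNIV \<Otimes>\<^sub>M borel"
  using indep assms unfolding indep_vars_def by auto

lemma measurable_\<nu>: "i \<in> {1..m} \<Longrightarrow> \<nu> i \<in> M \<rightarrow>\<^sub>M count_space UNIV"
  using measurable_compose[OF measurable_pair measurable_fst] by simp

lemma measurable_X: "i \<in> {1..m} \<Longrightarrow> X i \<in> borel_measurable M"
  using measurable_compose[OF measurable_pair measurable_snd] by simp

lemma measurable_observations: "observations m X \<in> M \<rightarrow>\<^sub>M (\<Pi>\<^sub>M j\<in>{1..m}. borel)"
  unfolding observations_def[abs_def] by (intro measurable_restrict measurable_X)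

lemma observations_nth: "i \<in> {1..m} \<Longrightarrow> observations m X \<omega> i = X i \<omega>"
  by (simp add: observations_def)

lemma prob_\<nu>: "i \<in> {1..m} \<Longrightarrow> prob {\<omega>\<in>space M. \<nu> i \<omega>} = p"
  using model by (simp add: two_groups_model_def)

lemma prob_not_\<nu>:
  assumes "i \<in> {1..m}"
  shows "prob {\<omega>\<in>space M. \<not> \<nu> i \<omega>} = 1 - p"
proof -
  note [measurable] = measurable_\<nu>[OF assms]
  show ?thesis
    using prob_neg[of "\<nu> i"] prob_\<nu>[OF assms] by simp
qed

lemma prob_\<nu>_X:
  assumes "i \<in> {1..m}" "B \<in> sets borel"
  shows "prob {\<omega>\<in>space M. \<nu> i \<omega> = b \<and> X i \<omega> \<in> B} =
    (if b then p * measure (centered_normal (\<sigma>2 + \<tau>2)) B else (1 - p) * measure (centered_normal \<sigma>2) B)"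
proof -
  have "\<P>(\<omega> in M. X i \<omega> \<in> B \<bar> \<not> \<nu> i \<omega>) = measure (centered_normal \<sigma>2) B"
    and "\<P>(\<omega> in M. X i \<omega> \<in> B \<bar> \<nu> i \<omega>) = measure (centered_normal (\<sigma>2 + \<tau>2)) B"
    using model assms unfolding two_groups_model_def by blast+
  then have "prob {\<omega>\<in>space M. X i \<omega> \<in> B \<and> \<not> \<nu> i \<omega>} / (1 - p) = measure (centered_normal \<sigma>2) B"
    and "prob {\<omega>\<in>space M. X i \<omega> \<in> B \<and> \<nu> i \<omega>} / p = measure (centered_normal (\<sigma>2 + \<tau>2)) B"
    unfolding cond_prob_def prob_\<nu>[OF assms(1)] prob_not_\<nu>[OF assms(1)] by simp_all
  then show ?thesis
    using p_pos p_less_1 by (cases b) (simp_all add: divide_eq_eq mult.commute conj_commute)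
qed

lemma prob_fixed_threshold:
  assumes "i \<in> {1..m}" "0 < c"
  defines "\<phi> \<equiv> fixed_threshold_rule \<sigma>2 c"
  shows "prob {\<omega>\<in>space M. \<not> \<nu> i \<omega> \<and> \<phi> i (observations m X \<omega>)} = (1 - p) * normal_tail c"
    and "prob {\<omega>\<in>space M. \<nu> i \<omega> \<and> \<phi> i (observations m X \<omega>)} =
      p * normal_tail (c / sqrt (1 + \<tau>2 / \<sigma>2))"
    and "prob {\<omega>\<in>space M. \<nu> i \<omega> \<and> \<not> \<phi> i (observations m X \<omega>)} =
      p * (1 - normal_tail (c / sqrt (1 + \<tau>2 / \<sigma>2)))"
proof -
  have *: "(\<sigma>2 + \<tau>2) / \<sigma>2 = 1 + \<tau>2 / \<sigma>2" "0 < \<sigma>2 + \<tau>2"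
    using \<sigma>2_pos \<tau>2_pos by (auto simp: field_simps)
  show "prob {\<omega>\<in>space M. \<not> \<nu> i \<omega> \<and> \<phi> i (observations m X \<omega>)} = (1 - p) * normal_tail c"
    using prob_\<nu>_X[OF assms(1), of "{x. c\<^sup>2 \<le> x\<^sup>2 / \<sigma>2}" False] assms \<sigma>2_pos
    by (simp add: \<phi>_def fixed_threshold_rule_def observations_nth measure_centered_normal_tail)
  show "prob {\<omega>\<in>space M. \<nu> i \<omega> \<and> \<phi> i (observations m X \<omega>)} =
      p * normal_tail (c / sqrt (1 + \<tau>2 / \<sigma>2))"
    using prob_\<nu>_X[OF assms(1), of "{x. c\<^sup>2 \<le> x\<^sup>2 / \<sigma>2}" True] assms \<sigma>2_pos *
    by (simp add: \<phi>_def fixed_threshold_rule_def observations_nth measure_centered_normal_tail)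
  show "prob {\<omega>\<in>space M. \<nu> i \<omega> \<and> \<not> \<phi> i (observations m X \<omega>)} =
      p * (1 - normal_tail (c / sqrt (1 + \<tau>2 / \<sigma>2)))"
    using prob_\<nu>_X[OF assms(1), of "{x. x\<^sup>2 / \<sigma>2 < c\<^sup>2}" True] assms \<sigma>2_pos *
    by (simp add: \<phi>_def fixed_threshold_rule_def observations_nth measure_centered_normal_below not_le)
qed

lemma type1_error_prob_fixed_threshold:
  assumes "i \<in> {1..m}" "0 < c"
  shows "type1_error_prob M m \<nu> X (fixed_threshold_rule \<sigma>2 c) i = normal_tail c"
  using prob_fixed_threshold(1)[OF assms] prob_not_\<nu>[OF assms(1)] p_less_1
  by (simp add: type1_error_prob_def cond_prob_def conj_commute)

lemma BFDR_fixed_threshold: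
  assumes "i \<in> {1..m}" "0 < c"
  shows "BFDR M m \<nu> X (fixed_threshold_rule \<sigma>2 c) i = (1 - p) * normal_tail c /
    ((1 - p) * normal_tail c + p * normal_tail (c / sqrt (1 + \<tau>2 / \<sigma>2)))"
proof -
  let ?\<phi> = "\<lambda>\<omega>. fixed_threshold_rule \<sigma>2 c i (observations m X \<omega>)"
  note [measurable] = measurable_\<nu>[OF assms(1)] measurable_observations
  have [measurable]: "Measurable.pred M ?\<phi>"
    using fixed_threshold_rule_in_testing_rules[of \<sigma>2 c m] assms(1)
    by (intro measurable_compose[OF measurable_observations]) (auto simp: testing_rules_def)
  have "{\<omega>\<in>space M. ?\<phi> \<omega>} = {\<omega>\<in>space M. \<not> \<nu> i \<omega> \<and> ?\<phi> \<omega>} \<union> {\<omega>\<in>space M. \<nu> i \<omega> \<and> ?\<phi> \<omega>}"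
    by auto
  also have "prob \<dots> = prob {\<omega>\<in>space M. \<not> \<nu> i \<omega> \<and> ?\<phi> \<omega>} + prob {\<omega>\<in>space M. \<nu> i \<omega> \<and> ?\<phi> \<omega>}"
    by (intro finite_measure_Union) auto
  finally show ?thesis
    using prob_fixed_threshold(1,2)[OF assms]
    by (simp add: BFDR_def cond_prob_def)
qed

lemma expectation_card:
  assumes "\<And>i. i \<in> {1..m} \<Longrightarrow> Measurable.pred M (P i)"
  shows "(\<integral>\<omega>. real (card {i\<in>{1..m}. P i \<omega>}) \<partial>M) = (\<Sum>i\<in>{1..m}. prob {\<omega>\<in>space M. P i \<omega>})"
proof -
  have "(\<integral>\<omega>. real (card {i\<in>{1..m}. P i \<omega>}) \<partial>M) =
      (\<integral>\<omega>. (\<Sum>i\<in>{1..m}. indicator {\<omega>\<in>space M. P i \<omega>} \<omega>) \<partial>M)"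
  proof (rule Bochner_Integration.integral_cong)
    fix \<omega> assume "\<omega> \<in> space M"
    then show "real (card {i\<in>{1..m}. P i \<omega>}) = (\<Sum>i\<in>{1..m}. indicator {\<omega>\<in>space M. P i \<omega>} \<omega>)"
      by (simp add: indicator_def sum.If_cases Int_def)
  qed simp
  also have "\<dots> = (\<Sum>i\<in>{1..m}. \<integral>\<omega>. indicator {\<omega>\<in>space M. P i \<omega>} \<omega> \<partial>M)"
    using assms by (intro Bochner_Integration.integral_sum integrable_real_indicator)
      (auto simp: emeasure_eq_measure)
  also have "\<dots> = (\<Sum>i\<in>{1..m}. prob {\<omega>\<in>space M. P i \<omega>})"
    by (simp add: Int_def conj_commute cong: conj_cong)
  finally show ?thesis .
qed

lemma bayes_risk_eq_sum:
  assumes "\<phi> \<in> testing_rules m"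
  shows "bayes_risk M m \<delta>0 \<delta>A \<nu> X \<phi> = (\<Sum>i\<in>{1..m}.
    \<delta>0 * prob {\<omega>\<in>space M. \<not> \<nu> i \<omega> \<and> \<phi> i (observations m X \<omega>)} +
    \<delta>A * prob {\<omega>\<in>space M. \<nu> i \<omega> \<and> \<not> \<phi> i (observations m X \<omega>)})"
proof -
  have "Measurable.pred M (\<lambda>\<omega>. \<phi> i (observations m X \<omega>))" if "i \<in> {1..m}" for i
    using assms that
    by (intro measurable_compose[OF measurable_observations]) (auto simp: testing_rules_def)
  then show ?thesis
    unfolding bayes_risk_def false_rejections_def false_acceptances_def
    by (subst (1 2) expectation_card)
       (auto simp: sum.distrib sum_distrib_left intro!: pred_intros_logic measurable_\<nu>)
qed

lemma bayes_risk_fixed_threshold: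
  assumes "0 < c"
  shows "bayes_risk M m \<delta>0 \<delta>A \<nu> X (fixed_threshold_rule \<sigma>2 c) =
    real m * (\<delta>0 * (1 - p) * normal_tail c + \<delta>A * p * (1 - normal_tail (c / sqrt (1 + \<tau>2 / \<sigma>2))))"
  using assms
  by (simp add: bayes_risk_eq_sum[OF fixed_threshold_rule_in_testing_rules] prob_fixed_threshold
      del: of_nat_mult atLeastAtMost_iff)


text \<open>
  The Bayes risk in one test is bounded below as in the Neyman-Pearson lemma: on a set \<open>S\<close> of values
  \<open>X\<^sub>i\<close> on which accepting \<open>H\<^sub>0\<^sub>i\<close> is always the cheaper decision, no rule does better than to accept.
  As the rule may depend on all the observations, the comparison is made for every fixed value \<open>z\<close> of the
  other observations and integrated by Fubini's theorem.
\<close>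

lemma single_test_risk_ge:
  assumes i: "i \<in> {1..m}" and \<phi>: "\<phi> \<in> testing_rules m" and S: "S \<in> sets borel"
    and \<delta>0: "0 \<le> \<delta>0" and \<delta>A: "0 \<le> \<delta>A"
    and le: "\<And>B. B \<in> sets borel \<Longrightarrow> B \<subseteq> S \<Longrightarrow>
      \<delta>A * p * measure (centered_normal (\<sigma>2 + \<tau>2)) B \<le> \<delta>0 * (1 - p) * measure (centered_normal \<sigma>2) B"
  shows "\<delta>A * p * measure (centered_normal (\<sigma>2 + \<tau>2)) S \<le>
    \<delta>0 * prob {\<omega>\<in>space M. \<not> \<nu> i \<omega> \<and> \<phi> i (observations m X \<omega>)} +
    \<delta>A * prob {\<omega>\<in>space M. \<nu> i \<omega> \<and> \<not> \<phi> i (observations m X \<omega>)}"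
proof -
  let ?J = "{1..m} - {i}" and ?B2 = "count_space UNIV \<Otimes>\<^sub>M borel :: (bool \<times> real) measure"
  let ?Y = "\<lambda>\<omega>. (\<nu> i \<omega>, X i \<omega>)" and ?Z = "\<lambda>\<omega>. \<lambda>j\<in>?J. X j \<omega>"
  let ?N = "(\<Pi>\<^sub>M j\<in>?J. borel) :: (nat \<Rightarrow> real) measure"
  let ?\<phi> = "\<lambda>\<omega>. \<phi> i (observations m X \<omega>)"
  have meas_\<phi> [measurable]: "Measurable.pred M ?\<phi>"
    using \<phi> i by (intro measurable_compose[OF measurable_observations]) (auto simp: testing_rules_def)
  note [measurable] = measurable_\<nu>[OF i] measurable_X[OF i] measurable_pair[OF i] S
  have Z [measurable]: "?Z \<in> M \<rightarrow>\<^sub>M ?N"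
    by (intro measurable_restrict measurable_X) auto
  let ?V = "\<lambda>J \<omega>. \<lambda>j\<in>J. (\<nu> j \<omega>, X j \<omega>)" and ?P = "\<lambda>J. \<Pi>\<^sub>M j\<in>J. ?B2"
  \<comment> \<open>Independence is stated for variables of one and the same type, so the law of \<open>(?Y, ?Z)\<close> is obtained as
    an image of that of the restrictions of the whole family to \<open>{i}\<close> and to \<open>?J\<close>.\<close>
  have "indep_var (?P {i}) (?V {i}) (?P ?J) (?V ?J)"
    using i by (intro indep_var_restrict[OF indep]) auto
  then have V [measurable]: "?V {i} \<in> M \<rightarrow>\<^sub>M ?P {i}" "?V ?J \<in> M \<rightarrow>\<^sub>M ?P ?J"
    and V_distr: "distr M (?P {i}) (?V {i}) \<Otimes>\<^sub>M distr M (?P ?J) (?V ?J) =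
      distr M (?P {i} \<Otimes>\<^sub>M ?P ?J) (\<lambda>\<omega>. (?V {i} \<omega>, ?V ?J \<omega>))"
    unfolding indep_var_distribution_eq by auto
  have proj [measurable]: "(\<lambda>g. g i) \<in> ?P {i} \<rightarrow>\<^sub>M ?B2" "(\<lambda>g. \<lambda>j\<in>?J. snd (g j)) \<in> ?P ?J \<rightarrow>\<^sub>M ?N"
    by (auto intro!: measurable_restrict)
  have Y_eq: "distr M ?B2 ?Y = distr (distr M (?P {i}) (?V {i})) ?B2 (\<lambda>g. g i)"
    and Z_eq: "distr M ?N ?Z = distr (distr M (?P ?J) (?V ?J)) ?N (\<lambda>g. \<lambda>j\<in>?J. snd (g j))"
    by (simp_all only: distr_distr[OF proj(1) V(1)] distr_distr[OF proj(2) V(2)])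
       (simp_all add: comp_def cong: restrict_cong)
  interpret Y: prob_space "distr M ?B2 ?Y"
    by (rule prob_space_distr[OF measurable_pair[OF i]])
  interpret Z: prob_space "distr M ?N ?Z"
    by (rule prob_space_distr[OF Z])
  interpret YZ: pair_prob_space "distr M ?B2 ?Y" "distr M ?N ?Z" ..
  have distr: "distr M ?B2 ?Y \<Otimes>\<^sub>M distr M ?N ?Z = distr M (?B2 \<Otimes>\<^sub>M ?N) (\<lambda>\<omega>. (?Y \<omega>, ?Z \<omega>))"
  proof -
    have "distr M ?B2 ?Y \<Otimes>\<^sub>M distr M ?N ?Z =
        distr (distr M (?P {i} \<Otimes>\<^sub>M ?P ?J) (\<lambda>\<omega>. (?V {i} \<omega>, ?V ?J \<omega>))) (?B2 \<Otimes>\<^sub>M ?N)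
          (\<lambda>(g, h). (g i, \<lambda>j\<in>?J. snd (h j)))"
      unfolding Y_eq Z_eq V_distr[symmetric]
      using Z.sigma_finite_measure_axioms unfolding Z_eq by (intro pair_measure_distr) auto
    also have "\<dots> = distr M (?B2 \<Otimes>\<^sub>M ?N) (\<lambda>\<omega>. (?Y \<omega>, ?Z \<omega>))"
    proof -
      have "(\<lambda>(g, h). (g i, \<lambda>j\<in>?J. snd (h j))) \<in> ?P {i} \<Otimes>\<^sub>M ?P ?J \<rightarrow>\<^sub>M ?B2 \<Otimes>\<^sub>M ?N"
        unfolding case_prod_unfold
        by (intro measurable_Pair measurable_compose[OF measurable_fst proj(1)]
            measurable_compose[OF measurable_snd proj(2)])
      from distr_distr[OF this measurable_Pair[OF V]] show ?thesis
        by (simp add: comp_def cong: restrict_cong)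
    qed
    finally show ?thesis .
  qed

  \<comment> \<open>The values in \<open>S\<close> of the \<open>i\<close>-th observation that lead to rejection when the others are \<open>z\<close>.\<close>
  define G where "G z = {x\<in>S. \<phi> i (z(i := x))}" for z
  have G_subset: "G z \<subseteq> S" for z
    by (auto simp: G_def)
  have obs: "observations m X \<omega> = (?Z \<omega>)(i := X i \<omega>)" for \<omega>
    using i by (auto simp: observations_def fun_eq_iff)
  have "(\<lambda>(z, x). z(i := x)) \<in> ?N \<Otimes>\<^sub>M borel \<rightarrow>\<^sub>M (\<Pi>\<^sub>M j\<in>insert i ?J. borel)"
    by (rule measurable_add_dim)
  also have "insert i ?J = {1..m}"
    using i by auto
  finally have upd: "(\<lambda>(z, x). z(i := x)) \<in> ?N \<Otimes>\<^sub>M borel \<rightarrow>\<^sub>M (\<Pi>\<^sub>M j\<in>{1..m}. borel)" .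
  have upd_pred: "Measurable.pred (?N \<Otimes>\<^sub>M borel) (\<lambda>(z, x). \<phi> i (z(i := x)))"
    using measurable_compose[OF upd, of "\<phi> i" "count_space UNIV"] \<phi> i
    by (simp add: testing_rules_def case_prod_unfold)
  have G_sets: "G z \<in> sets borel" if "z \<in> space ?N" for z
  proof -
    have "Measurable.pred borel (\<lambda>x. \<phi> i (z(i := x)))"
      using measurable_compose[OF measurable_Pair1'[OF that] upd_pred] by simp
    then show ?thesis
      unfolding G_def by measurable
  qed
  have joint: "(\<lambda>z. ennreal (prob {\<omega>\<in>space M. \<nu> i \<omega> = b \<and> X i \<omega> \<in> G z})) \<in>
        borel_measurable (distr M ?N ?Z)" (is ?meas)
    "emeasure M {\<omega>\<in>space M. \<nu> i \<omega> = b \<and> X i \<omega> \<in> S \<and> ?\<phi> \<omega>} =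
      (\<integral>\<^sup>+z. ennreal (prob {\<omega>\<in>space M. \<nu> i \<omega> = b \<and> X i \<omega> \<in> G z}) \<partial>distr M ?N ?Z)" (is ?eq) for b
  proof -
    define A where "A = {w\<in>space (?B2 \<Otimes>\<^sub>M ?N).
      fst (fst w) = b \<and> snd (fst w) \<in> S \<and> \<phi> i ((snd w)(i := snd (fst w)))}"
    have "Measurable.pred (?B2 \<Otimes>\<^sub>M ?N) (\<lambda>w. \<phi> i ((snd w)(i := snd (fst w))))"
      using measurable_compose[of "\<lambda>w. (snd w, snd (fst w))" "?B2 \<Otimes>\<^sub>M ?N", OF _ upd_pred] by simp
    then have A: "A \<in> sets (?B2 \<Otimes>\<^sub>M ?N)"
      unfolding A_def by measurable
    have slice: "emeasure (distr M ?B2 ?Y) ((\<lambda>y. (y, z)) -` A) =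
        ennreal (prob {\<omega>\<in>space M. \<nu> i \<omega> = b \<and> X i \<omega> \<in> G z})"
      if "z \<in> space (distr M ?N ?Z)" for z
    proof -
      have z: "z \<in> space ?N"
        using that by simp
      have "(\<lambda>y. (y, z)) -` A = {b} \<times> G z"
        using z by (auto simp: A_def G_def space_pair_measure)
      moreover have "{b} \<times> G z \<in> sets ?B2"
        using G_sets[OF z] by simp
      moreover have "?Y -` ({b} \<times> G z) \<inter> space M = {\<omega>\<in>space M. \<nu> i \<omega> = b \<and> X i \<omega> \<in> G z}"
        by auto
      ultimately show ?thesis
        by (simp add: emeasure_distr emeasure_eq_measure)
    qed
    have "{\<omega>\<in>space M. \<nu> i \<omega> = b \<and> X i \<omega> \<in> S \<and> ?\<phi> \<omega>} = (\<lambda>\<omega>. (?Y \<omega>, ?Z \<omega>)) -` A \<inter> space M"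
      using measurable_space[OF Z] by (auto simp: A_def obs space_pair_measure)
    then have "emeasure M {\<omega>\<in>space M. \<nu> i \<omega> = b \<and> X i \<omega> \<in> S \<and> ?\<phi> \<omega>} =
        emeasure (distr M ?B2 ?Y \<Otimes>\<^sub>M distr M ?N ?Z) A"
      unfolding distr emeasure_distr[OF measurable_Pair[OF measurable_pair[OF i] Z] A] by simp
    also have "\<dots> = (\<integral>\<^sup>+z. emeasure (distr M ?B2 ?Y) ((\<lambda>y. (y, z)) -` A) \<partial>distr M ?N ?Z)"
      using A by (intro YZ.emeasure_pair_measure_alt2) simp
    also have "\<dots> = (\<integral>\<^sup>+z. ennreal (prob {\<omega>\<in>space M. \<nu> i \<omega> = b \<and> X i \<omega> \<in> G z}) \<partial>distr M ?N ?Z)"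
      by (intro nn_integral_cong slice)
    finally show ?eq .
    have "(\<lambda>z. emeasure (distr M ?B2 ?Y) ((\<lambda>y. (y, z)) -` A)) \<in> borel_measurable (distr M ?N ?Z)"
      using A by (intro YZ.measurable_emeasure_Pair2) simp
    then show ?meas
      by (subst (asm) measurable_cong[OF slice])
  qed

  have "ennreal \<delta>A * emeasure M {\<omega>\<in>space M. \<nu> i \<omega> = True \<and> X i \<omega> \<in> S \<and> ?\<phi> \<omega>} \<le>
      ennreal \<delta>0 * emeasure M {\<omega>\<in>space M. \<nu> i \<omega> = False \<and> X i \<omega> \<in> S \<and> ?\<phi> \<omega>}"
  proof -
    show ?thesis
      unfolding joint(2) nn_integral_cmult[OF joint(1), symmetric]
    proof (intro nn_integral_mono)
      fix z assume "z \<in> space (distr M ?N ?Z)"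
      then show "ennreal \<delta>A * ennreal (prob {\<omega>\<in>space M. \<nu> i \<omega> = True \<and> X i \<omega> \<in> G z}) \<le>
          ennreal \<delta>0 * ennreal (prob {\<omega>\<in>space M. \<nu> i \<omega> = False \<and> X i \<omega> \<in> G z})"
        using le[of "G z"] G_sets[of z] \<delta>0 \<delta>A prob_\<nu>_X[OF i G_sets[of z], of True]
          prob_\<nu>_X[OF i G_sets[of z], of False]
        by (simp add: ennreal_mult'[symmetric] ennreal_leI G_subset mult.assoc)
    qed
  qed
  \<comment> \<open>Within \<open>S\<close>, a correct rejection saves no more than the false rejections cost.\<close>
  then have swap: "\<delta>A * prob {\<omega>\<in>space M. \<nu> i \<omega> \<and> X i \<omega> \<in> S \<and> ?\<phi> \<omega>} \<le>
      \<delta>0 * prob {\<omega>\<in>space M. \<not> \<nu> i \<omega> \<and> X i \<omega> \<in> S \<and> ?\<phi> \<omega>}"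
    using \<delta>0 \<delta>A by (simp add: emeasure_eq_measure ennreal_mult[symmetric] ennreal_le_iff)

  have "p * measure (centered_normal (\<sigma>2 + \<tau>2)) S = prob {\<omega>\<in>space M. \<nu> i \<omega> \<and> X i \<omega> \<in> S}"
    using prob_\<nu>_X[OF i S, of True] by simp
  also have "{\<omega>\<in>space M. \<nu> i \<omega> \<and> X i \<omega> \<in> S} = {\<omega>\<in>space M. \<nu> i \<omega> \<and> X i \<omega> \<in> S \<and> ?\<phi> \<omega>} \<union>
      {\<omega>\<in>space M. \<nu> i \<omega> \<and> X i \<omega> \<in> S \<and> \<not> ?\<phi> \<omega>}"
    by auto
  also have "prob \<dots> = prob {\<omega>\<in>space M. \<nu> i \<omega> \<and> X i \<omega> \<in> S \<and> ?\<phi> \<omega>} +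
      prob {\<omega>\<in>space M. \<nu> i \<omega> \<and> X i \<omega> \<in> S \<and> \<not> ?\<phi> \<omega>}"
    by (intro finite_measure_Union) auto
  finally have "\<delta>A * p * measure (centered_normal (\<sigma>2 + \<tau>2)) S =
      \<delta>A * prob {\<omega>\<in>space M. \<nu> i \<omega> \<and> X i \<omega> \<in> S \<and> ?\<phi> \<omega>} +
      \<delta>A * prob {\<omega>\<in>space M. \<nu> i \<omega> \<and> X i \<omega> \<in> S \<and> \<not> ?\<phi> \<omega>}"
    by (simp add: algebra_simps)
  moreover have "\<delta>0 * prob {\<omega>\<in>space M. \<not> \<nu> i \<omega> \<and> X i \<omega> \<in> S \<and> ?\<phi> \<omega>} \<le>
      \<delta>0 * prob {\<omega>\<in>space M. \<not> \<nu> i \<omega> \<and> ?\<phi> \<omega>}"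
    using \<delta>0 by (intro mult_left_mono finite_measure_mono) auto
  moreover have "\<delta>A * prob {\<omega>\<in>space M. \<nu> i \<omega> \<and> X i \<omega> \<in> S \<and> \<not> ?\<phi> \<omega>} \<le>
      \<delta>A * prob {\<omega>\<in>space M. \<nu> i \<omega> \<and> \<not> ?\<phi> \<omega>}"
    using \<delta>A by (intro mult_left_mono finite_measure_mono) auto
  ultimately show ?thesis
    using swap by linarith
qed

text \<open>
  For \<open>v = u * f\<^sup>2 * \<delta>\<^sup>2\<close> the hypothesis \<open>le\<close> says that \<open>sqrt u \<le> sqrt (1 + u)\<close>. The second bound also
  requires that the risks are bounded below, because \<^const>\<open>optimal_risk\<close> is an infimum of reals.
\<close>

lemma optimal_risk_bounds:
  assumes \<delta>0: "0 \<le> \<delta>0" and \<delta>A: "0 \<le> \<delta>A" and v: "1 < v"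
    and le: "\<delta>A * p * sqrt v \<le> \<delta>0 * (1 - p) * sqrt (1 + \<tau>2 / \<sigma>2)"
  shows "real m * (\<delta>A * p * (1 - normal_tail (sqrt (ln v) / sqrt (1 + \<tau>2 / \<sigma>2)))) \<le>
      optimal_risk M m \<delta>0 \<delta>A \<nu> X"
    and "\<phi> \<in> testing_rules m \<Longrightarrow> optimal_risk M m \<delta>0 \<delta>A \<nu> X \<le> bayes_risk M m \<delta>0 \<delta>A \<nu> X \<phi>"
proof -
  have var: "(\<sigma>2 + \<tau>2) / \<sigma>2 = 1 + \<tau>2 / \<sigma>2" "0 < \<sigma>2 + \<tau>2"
    using \<sigma>2_pos \<tau>2_pos by (auto simp: field_simps)
  have risk_ge: "real m * (\<delta>A * p * (1 - normal_tail (sqrt (ln v) / sqrt (1 + \<tau>2 / \<sigma>2)))) \<le>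
      bayes_risk M m \<delta>0 \<delta>A \<nu> X \<phi>" if \<phi>: "\<phi> \<in> testing_rules m" for \<phi>
  proof -
    let ?S = "{x. x\<^sup>2 / \<sigma>2 < ln v}"
    have S: "?S \<in> sets borel"
      by measurable
    have "measure (centered_normal (\<sigma>2 + \<tau>2)) ?S =
        1 - normal_tail (sqrt (ln v) / sqrt (1 + \<tau>2 / \<sigma>2))"
      using measure_centered_normal_below[of "\<sigma>2 + \<tau>2" \<sigma>2 "sqrt (ln v)"] v \<sigma>2_pos var by simp
    moreover have "\<delta>A * p * measure (centered_normal (\<sigma>2 + \<tau>2)) ?S \<le>
      \<delta>0 * prob {\<omega>\<in>space M. \<not> \<nu> i \<omega> \<and> \<phi> i (observations m X \<omega>)} +
      \<delta>A * prob {\<omega>\<in>space M. \<nu> i \<omega> \<and> \<not> \<phi> i (observations m X \<omega>)}" if "i \<in> {1..m}" for i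
      using that v \<phi> S \<delta>0 \<delta>A le p_pos p_less_1 \<sigma>2_pos \<tau>2_pos
      by (intro single_test_risk_ge centered_normal_mult_le[of _ _ v]) auto
    ultimately have "real (card {1..m}) * (\<delta>A * p * (1 - normal_tail (sqrt (ln v) / sqrt (1 + \<tau>2 / \<sigma>2)))) \<le>
      bayes_risk M m \<delta>0 \<delta>A \<nu> X \<phi>"
      unfolding bayes_risk_eq_sum[OF \<phi>] by (intro sum_bounded_below) simp
    then show ?thesis
      by simp
  qed
  have ne: "testing_rules m \<noteq> {}"
    using fixed_threshold_rule_in_testing_rules by auto
  show "real m * (\<delta>A * p * (1 - normal_tail (sqrt (ln v) / sqrt (1 + \<tau>2 / \<sigma>2)))) \<le>
      optimal_risk M m \<delta>0 \<delta>A \<nu> X"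
    unfolding optimal_risk_def by (rule cINF_greatest[OF ne risk_ge])
  show "optimal_risk M m \<delta>0 \<delta>A \<nu> X \<le> bayes_risk M m \<delta>0 \<delta>A \<nu> X \<phi>" if "\<phi> \<in> testing_rules m"
    unfolding optimal_risk_def using that
    by (intro cINF_lower bdd_belowI2[of _ "real m * (\<delta>A * p * (1 - normal_tail (sqrt (ln v) / sqrt (1 + \<tau>2 / \<sigma>2))))"] risk_ge)
qed

end

section \<open>Asymptotics of the threshold determined by the BFDR\<close>

text \<open>
  The analytic content of the problem, without probability spaces: \<open>L\<close> stands for \<open>ln (f / r)\<close>, and the
  assumption \<open>bfdr\<close> is the logarithm of the equation \<open>f * Q c = r * Q (c / sqrt (1 + u))\<close> for the
  threshold \<open>c\<close>.
\<close>

locale bfdr_threshold_asymptotics =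
  fixes u v L s c :: "nat \<Rightarrow> real" and C :: real
  assumes u_pos: "\<And>t. 0 < u t" and v_pos: "\<And>t. 0 < v t"
    and c_pos: "\<And>t. 0 < c t" and L_pos: "\<And>t. 0 < L t"
    and u_lim: "filterlim u at_top sequentially"
    and C_pos: "0 < C" and C_lim: "(\<lambda>t. ln (v t) / u t) \<longlonglongrightarrow> C"
    and bfdr: "\<And>t. ln (normal_tail (c t / sqrt (1 + u t))) - ln (normal_tail (c t)) = L t"
    and s_eq: "\<And>t. ln (v t) / 2 / L t = 1 + s t"
begin

text \<open>
  The threshold on the scale of the alternative distribution; the relative weight \<open>f * \<delta>\<close> of a type I
  error, written as \<open>sqrt (v / u)\<close>; the normalised risk of the rule; and the limit \<open>\<beta>\<close> of the power, which is the constant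
  \<open>D\<close> of the theorem.
\<close>

definition y :: "nat \<Rightarrow> real" where "y t = c t / sqrt (1 + u t)"
definition k :: "nat \<Rightarrow> real" where "k t = sqrt (v t / u t)"
definition \<rho> :: "nat \<Rightarrow> real" where
  "\<rho> t = k t * normal_tail (c t) + (1 - normal_tail (y t))"
definition \<beta> :: real where "\<beta> = normal_tail (sqrt C)"

lemma y_pos: "0 < y t"
  using c_pos u_pos[of t] by (simp add: y_def)

lemma k_pos: "0 < k t"
  using u_pos v_pos by (simp add: k_def)

lemma \<beta>_pos: "0 < \<beta>"
  using C_pos by (simp add: \<beta>_def normal_tail_pos)

lemma c_eq: "c t = y t * sqrt (1 + u t)"
  using u_pos[of t] by (simp add: y_def)

lemma c_sq: "(c t)\<^sup>2 = (y t)\<^sup>2 * (1 + u t)"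
  using u_pos[of t] by (simp add: c_eq power_mult_distrib)

lemma ln_k: "ln (k t) = ln (v t) / 2 - ln (u t) / 2"
  using u_pos[of t] v_pos[of t] by (simp add: k_def ln_sqrt ln_div diff_divide_distrib)

lemma ln_type1_term: "2 * ln (k t * normal_tail (c t)) =
  2 * s t * L t - ln (L t) + 2 * ln (normal_tail (y t)) - ln (u t / L t)"
proof -
  have "ln (v t) / 2 = L t + s t * L t"
    using s_eq[of t] L_pos[of t] by (simp add: field_simps)
  moreover have "ln (k t * normal_tail (c t)) = ln (k t) + ln (normal_tail (c t))"
    using k_pos[of t] normal_tail_pos[of "c t"] c_pos[of t] by (simp add: ln_mult)
  moreover have "ln (u t / L t) = ln (u t) - ln (L t)"
    using u_pos[of t] L_pos[of t] by (simp add: ln_div)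
  ultimately show ?thesis
    using ln_k[of t] bfdr[of t, folded y_def] by linarith
qed

lemma ln_normal_tail_y_lim:
  assumes "y \<longlonglongrightarrow> sqrt C"
  shows "(\<lambda>t. normal_tail (y t)) \<longlonglongrightarrow> \<beta>" and "(\<lambda>t. ln (normal_tail (y t))) \<longlonglongrightarrow> ln \<beta>"
proof -
  show "(\<lambda>t. normal_tail (y t)) \<longlonglongrightarrow> \<beta>"
    unfolding \<beta>_def by (rule isCont_tendsto_compose[OF isCont_normal_tail assms])
  then show "(\<lambda>t. ln (normal_tail (y t))) \<longlonglongrightarrow> ln \<beta>"
    using \<beta>_pos by (intro tendsto_ln) auto
qed

lemma sqrt_u_ratio_lim:
  "(\<lambda>t. sqrt (1 + u t) / u t) \<longlonglongrightarrow> 0" "(\<lambda>t. (1 + u t) / u t) \<longlonglongrightarrow> 1" "(\<lambda>t. 1 / u t) \<longlonglongrightarrow> 0"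
  "(\<lambda>t. ln (u t) / u t) \<longlonglongrightarrow> 0"
  by (rule filterlim_compose[OF _ u_lim], real_asymp)+

lemma div_u_eq:
  "(a * (1 + u t) / 2 + b + 1) / u t = a * ((1 + u t) / u t) / 2 + b / u t + 1 / u t"
  using u_pos[of t] by (simp add: field_simps)

text \<open>The null tail probability beyond \<open>a * sqrt (1 + u)\<close> is \<open>exp (- b\<^sup>2 * u / 2)\<close> up to a factor \<open>exp (o(u))\<close>.\<close>

lemma minus_ln_normal_tail_scaled_lim:
  assumes "a \<longlonglongrightarrow> b" "\<And>t. 0 \<le> a t"
  shows "(\<lambda>t. - ln (normal_tail (a t * sqrt (1 + u t))) / u t) \<longlonglongrightarrow> b\<^sup>2 / 2"
proof (rule tendsto_sandwich)
  have sq: "(a t * sqrt (1 + u t))\<^sup>2 = (a t)\<^sup>2 * (1 + u t)" and nn: "0 \<le> a t * sqrt (1 + u t)" for t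
    using u_pos[of t] assms(2)[of t] by (simp_all add: power_mult_distrib)
  show "\<forall>\<^sub>F t in sequentially. ((a t)\<^sup>2 * ((1 + u t) / u t) - 1 / u t) / 2 \<le>
      - ln (normal_tail (a t * sqrt (1 + u t))) / u t"
  proof (intro always_eventually allI)
    fix t
    have "((a t)\<^sup>2 * (1 + u t) - 1) / 2 / u t \<le> - ln (normal_tail (a t * sqrt (1 + u t))) / u t"
      using minus_ln_normal_tail_ge[OF nn[of t]] u_pos[of t] unfolding sq
      by (intro divide_right_mono) auto
    then show "((a t)\<^sup>2 * ((1 + u t) / u t) - 1 / u t) / 2 \<le>
        - ln (normal_tail (a t * sqrt (1 + u t))) / u t"
      by (simp add: diff_divide_distrib mult.commute)
  qed
  show "\<forall>\<^sub>F t in sequentially. - ln (normal_tail (a t * sqrt (1 + u t))) / u t \<le>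
      (a t)\<^sup>2 * ((1 + u t) / u t) / 2 + a t * (sqrt (1 + u t) / u t) + 1 / u t"
  proof (intro always_eventually allI)
    fix t
    have "- ln (normal_tail (a t * sqrt (1 + u t))) / u t \<le>
        ((a t)\<^sup>2 * (1 + u t) / 2 + a t * sqrt (1 + u t) + 1) / u t"
      using minus_ln_normal_tail_le[OF nn[of t]] u_pos[of t] unfolding sq
      by (intro divide_right_mono) auto
    then show "- ln (normal_tail (a t * sqrt (1 + u t))) / u t \<le>
        (a t)\<^sup>2 * ((1 + u t) / u t) / 2 + a t * (sqrt (1 + u t) / u t) + 1 / u t"
      by (simp only: div_u_eq times_divide_eq_right)
  qed
  have "(\<lambda>t. ((a t)\<^sup>2 * ((1 + u t) / u t) - 1 / u t) / 2) \<longlonglongrightarrow> (b\<^sup>2 * 1 - 0) / 2"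
    by (intro tendsto_intros assms sqrt_u_ratio_lim) simp
  then show "(\<lambda>t. ((a t)\<^sup>2 * ((1 + u t) / u t) - 1 / u t) / 2) \<longlonglongrightarrow> b\<^sup>2 / 2"
    by simp
  have "(\<lambda>t. (a t)\<^sup>2 * ((1 + u t) / u t) / 2 + a t * (sqrt (1 + u t) / u t) + 1 / u t)
      \<longlonglongrightarrow> b\<^sup>2 * 1 / 2 + b * 0 + 0"
    by (intro tendsto_intros assms sqrt_u_ratio_lim) simp
  then show "(\<lambda>t. (a t)\<^sup>2 * ((1 + u t) / u t) / 2 + a t * (sqrt (1 + u t) / u t) + 1 / u t)
      \<longlonglongrightarrow> b\<^sup>2 / 2"
    by simp
qed

lemma y_lim_if_risk_lim:
  assumes "\<rho> \<longlonglongrightarrow> 1 - \<beta>"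
  shows "y \<longlonglongrightarrow> sqrt C"
proof (rule order_tendstoI)
  fix a assume a: "sqrt C < a"
  then have "normal_tail a < \<beta>"
    unfolding \<beta>_def using C_pos by (intro normal_tail_strict_antimono) auto
  then have "\<forall>\<^sub>F t in sequentially. \<rho> t < 1 - normal_tail a"
    using assms by (intro order_tendstoD) auto
  then show "\<forall>\<^sub>F t in sequentially. y t < a"
  proof eventually_elim
    case (elim t)
    have "0 \<le> k t * normal_tail (c t)"
      using k_pos[of t] normal_tail_nonneg[of "c t"] by simp
    then have "normal_tail a < normal_tail (y t)"
      using elim by (simp add: \<rho>_def)
    then show ?case
      using normal_tail_antimono[of a "y t"] by linarith
  qed
next
  fix b assume b: "b < sqrt C"
  \<comment> \<open>The case \<open>y \<le> b'\<close> is excluded because the type I term would exceed \<open>1\<close>: its logarithm is at least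
    \<open>u * (C - b'\<^sup>2) / 2\<close> up to a term of smaller order.\<close>
  define b' where "b' = max b 0"
  have b': "0 \<le> b'" "b \<le> b'" "b' < sqrt C"
    using b C_pos by (auto simp: b'_def)
  have "b'\<^sup>2 < C"
    using b' C_pos power_strict_mono[of b' "sqrt C" 2] by simp
  have "(\<lambda>t. (ln (v t) / u t) / 2 - (ln (u t) / u t) / 2
      - (- ln (normal_tail (b' * sqrt (1 + u t))) / u t)) \<longlonglongrightarrow> C / 2 - 0 / 2 - b'\<^sup>2 / 2"
    by (rule tendsto_diff[OF tendsto_diff[OF tendsto_divide[OF C_lim tendsto_const]
        tendsto_divide[OF sqrt_u_ratio_lim(4) tendsto_const]]
        minus_ln_normal_tail_scaled_lim[OF tendsto_const b'(1)]]) auto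
  then have "\<forall>\<^sub>F t in sequentially. 0 < (ln (v t) / u t) / 2 - (ln (u t) / u t) / 2
      - (- ln (normal_tail (b' * sqrt (1 + u t))) / u t)"
    using \<open>b'\<^sup>2 < C\<close> by (intro order_tendstoD) auto
  moreover have "\<forall>\<^sub>F t in sequentially. \<rho> t < 1"
    using assms \<beta>_pos by (intro order_tendstoD) auto
  ultimately show "\<forall>\<^sub>F t in sequentially. b < y t"
  proof eventually_elim
    case (elim t)
    show ?case
    proof (rule ccontr)
      assume "\<not> b < y t"
      then have "c t \<le> b' * sqrt (1 + u t)"
        unfolding c_eq[of t] using b'(2) u_pos[of t] by (intro mult_right_mono) auto
      moreover define q where "q = normal_tail (b' * sqrt (1 + u t))"
      ultimately have "q \<le> normal_tail (c t)"
        by (simp add: normal_tail_antimono)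
      have "0 < q"
        unfolding q_def using b' u_pos[of t] by (intro normal_tail_pos) auto
      have "0 < (ln (v t) / 2 - ln (u t) / 2 + ln q) / u t"
        using elim(1) unfolding q_def[symmetric] by (simp add: diff_divide_distrib add_divide_distrib)
      then have "0 < ln (k t) + ln q"
        using u_pos[of t] by (simp add: ln_k zero_less_divide_iff)
      also have "\<dots> = ln (k t * q)"
        using k_pos[of t] \<open>0 < q\<close> by (simp add: ln_mult)
      finally have "1 < k t * q"
        using k_pos[of t] \<open>0 < q\<close> by simp
      also have "\<dots> \<le> k t * normal_tail (c t)"
        using k_pos[of t] \<open>q \<le> normal_tail (c t)\<close> by simp
      also have "\<dots> \<le> \<rho> t"
        using normal_tail_le_1[of "y t"] y_pos[of t] by (simp add: \<rho>_def)
      finally show False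
        using elim(2) by simp
    qed
  qed
qed

lemma y_lim_imp:
  assumes "y \<longlonglongrightarrow> sqrt C"
  shows "(\<lambda>t. L t / u t) \<longlonglongrightarrow> C / 2" and "s \<longlonglongrightarrow> 0" and "filterlim c at_top sequentially"
proof -
  have "(\<lambda>t. - ln (normal_tail (y t * sqrt (1 + u t))) / u t + ln (normal_tail (y t)) * (1 / u t))
      \<longlonglongrightarrow> (sqrt C)\<^sup>2 / 2 + ln \<beta> * 0"
    by (rule tendsto_add[OF minus_ln_normal_tail_scaled_lim[OF assms less_imp_le[OF y_pos]]
        tendsto_mult[OF ln_normal_tail_y_lim(2)[OF assms] sqrt_u_ratio_lim(3)]])
  moreover have "- ln (normal_tail (y t * sqrt (1 + u t))) / u t + ln (normal_tail (y t)) * (1 / u t) =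
      L t / u t" for t
    using bfdr[of t] u_pos[of t] unfolding c_eq[of t, symmetric] y_def[symmetric]
    by (simp add: field_simps)
  ultimately show *: "(\<lambda>t. L t / u t) \<longlonglongrightarrow> C / 2"
    using C_pos by simp
  have "(\<lambda>t. (ln (v t) / u t) / 2 / (L t / u t) - 1) \<longlonglongrightarrow> C / 2 / (C / 2) - 1"
    using C_pos by (intro tendsto_diff tendsto_divide tendsto_const C_lim *) auto
  moreover have "(ln (v t) / u t) / 2 / (L t / u t) - 1 = s t" for t
    using s_eq[of t] u_pos[of t] L_pos[of t] by (simp add: field_simps)
  ultimately show "s \<longlonglongrightarrow> 0"
    using C_pos by simp
  have "filterlim (\<lambda>t. sqrt (1 + u t)) at_top sequentially"
    by (rule filterlim_compose[OF _ u_lim]) real_asymp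
  then have "filterlim (\<lambda>t. y t * sqrt (1 + u t)) at_top sequentially"
    using C_pos by (intro filterlim_tendsto_pos_mult_at_top[OF assms]) auto
  then show "filterlim c at_top sequentially"
    by (simp only: c_eq[symmetric])
qed

lemma type1_term_lim_iff:
  assumes "y \<longlonglongrightarrow> sqrt C" "(\<lambda>t. L t / u t) \<longlonglongrightarrow> C / 2"
  shows "(\<lambda>t. k t * normal_tail (c t)) \<longlonglongrightarrow> 0 \<longleftrightarrow>
    filterlim (\<lambda>t. 2 * s t * L t - ln (L t)) at_bot sequentially"
proof -
  let ?g = "\<lambda>t. k t * normal_tail (c t)" and ?h = "\<lambda>t. 2 * s t * L t - ln (L t)"
  let ?r = "\<lambda>t. 2 * ln (normal_tail (y t)) - ln (u t / L t)"
  have g_pos: "0 < ?g t" for t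
    using k_pos[of t] c_pos[of t] by (intro mult_pos_pos) (auto intro!: normal_tail_pos less_imp_le)
  have "(\<lambda>t. inverse (L t / u t)) \<longlonglongrightarrow> inverse (C / 2)"
    using assms(2) C_pos by (intro tendsto_inverse) auto
  then have "(\<lambda>t. u t / L t) \<longlonglongrightarrow> 2 / C"
    by simp
  then have "(\<lambda>t. ln (u t / L t)) \<longlonglongrightarrow> ln (2 / C)"
    using C_pos by (intro tendsto_ln) auto
  then have r: "?r \<longlonglongrightarrow> 2 * ln \<beta> - ln (2 / C)"
    by (intro tendsto_diff tendsto_mult_left ln_normal_tail_y_lim assms(1))
  have eq: "2 * ln (?g t) = ?r t + ?h t" for t
    using ln_type1_term[of t] by simp
  have "?g \<longlonglongrightarrow> 0 \<longleftrightarrow> filterlim (\<lambda>t. ln (?g t)) at_bot sequentially"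
  proof
    assume "?g \<longlonglongrightarrow> 0"
    then have "filterlim ?g (at_right 0) sequentially"
      using g_pos by (intro tendsto_imp_filterlim_at_right) auto
    then show "filterlim (\<lambda>t. ln (?g t)) at_bot sequentially"
      by (rule filterlim_compose[OF ln_at_0])
  next
    assume "filterlim (\<lambda>t. ln (?g t)) at_bot sequentially"
    from filterlim_compose[OF exp_at_bot this] show "?g \<longlonglongrightarrow> 0"
      using g_pos by simp
  qed
  also have "\<dots> \<longleftrightarrow> filterlim (\<lambda>t. 2 * ln (?g t)) at_bot sequentially"
    by (rule filterlim_tendsto_pos_mult_at_bot_iff[of "\<lambda>_. 2" 2, symmetric]) auto
  also have "\<dots> \<longleftrightarrow> filterlim ?h at_bot sequentially"
    unfolding eq by (rule filterlim_tendsto_add_at_bot_iff[OF r])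
  finally show ?thesis .
qed

lemma L_lim_if_s_lim:
  assumes "s \<longlonglongrightarrow> 0"
  shows "(\<lambda>t. L t / u t) \<longlonglongrightarrow> C / 2"
proof -
  have "(\<lambda>t. (ln (v t) / u t) / 2 / (1 + s t)) \<longlonglongrightarrow> C / 2 / (1 + 0)"
    by (intro tendsto_intros C_lim assms) auto
  moreover have "\<forall>\<^sub>F t in sequentially. -1 < s t"
    using assms by (intro order_tendstoD) auto
  then have "\<forall>\<^sub>F t in sequentially. (ln (v t) / u t) / 2 / (1 + s t) = L t / u t"
  proof eventually_elim
    case (elim t)
    have "ln (v t) / 2 = (1 + s t) * L t"
      using s_eq[of t] L_pos[of t] by (simp add: field_simps)
    moreover have "(ln (v t) / u t) / 2 / (1 + s t) = (ln (v t) / 2) / (1 + s t) / u t"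
      by simp
    ultimately show ?case
      using elim by simp
  qed
  ultimately show ?thesis
    using tendsto_cong by force
qed

text \<open>
  The crude tail bounds turn the BFDR equation into two inequalities between \<open>y\<^sup>2\<close> and \<open>2 * L / u\<close>.
  The first one shows that \<open>y\<close> is bounded, after which the error terms of both vanish.
\<close>

lemma y_lim_if_s_lim:
  assumes "s \<longlonglongrightarrow> 0"
  shows "y \<longlonglongrightarrow> sqrt C"
proof -
  define w where "w t = L t / u t" for t
  have w: "w \<longlonglongrightarrow> C / 2"
    using L_lim_if_s_lim[OF assms] by (simp add: w_def[abs_def])
  have upper: "(y t)\<^sup>2 \<le> 2 * w t + 2 * (y t / u t) + 3 * (1 / u t)" for t
  proof -
    have "((c t)\<^sup>2 - 1) / 2 \<le> L t + (y t)\<^sup>2 / 2 + y t + 1"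
      using minus_ln_normal_tail_ge[of "c t"] minus_ln_normal_tail_le[of "y t"]
        c_pos[of t] y_pos[of t] bfdr[of t, folded y_def] by linarith
    then have "(y t)\<^sup>2 * u t \<le> 2 * L t + 2 * y t + 3"
      by (simp add: c_sq distrib_left)
    then have "(y t)\<^sup>2 \<le> (2 * L t + 2 * y t + 3) / u t"
      using u_pos[of t] by (simp add: pos_le_divide_eq)
    then show ?thesis
      by (simp add: w_def add_divide_distrib)
  qed
  have double: "x \<le> a / 2 + b + d \<Longrightarrow> 2 * x \<le> a + 2 * b + 2 * d" for x a b d :: real
    by simp
  have lower: "2 * w t \<le> (y t)\<^sup>2 * ((1 + u t) / u t) + 2 * (y t * (sqrt (1 + u t) / u t)) + 2 * (1 / u t)" for t
  proof -
    have "L t \<le> (c t)\<^sup>2 / 2 + c t + 1"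
      using minus_ln_normal_tail_le[of "c t"] normal_tail_le_1[of "y t"] bfdr[of t, folded y_def]
        c_pos[of t] y_pos[of t] normal_tail_pos[of "y t"] ln_le_zero_iff[of "normal_tail (y t)"]
      by linarith
    also have "\<dots> = (y t)\<^sup>2 * (1 + u t) / 2 + y t * sqrt (1 + u t) + 1"
      unfolding c_sq c_eq[symmetric] ..
    finally have "L t / u t \<le> ((y t)\<^sup>2 * (1 + u t) / 2 + y t * sqrt (1 + u t) + 1) / u t"
      using u_pos[of t] by (intro divide_right_mono) auto
    also have "\<dots> = (y t)\<^sup>2 * ((1 + u t) / u t) / 2 + y t * (sqrt (1 + u t) / u t) + 1 / u t"
      by (simp only: div_u_eq times_divide_eq_right)
    finally show ?thesis
      unfolding w_def by (rule double)
  qed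
  have y_bdd: "\<forall>\<^sub>F t in sequentially. \<bar>y t\<bar> \<le> 2 * (C + 1) + 8"
  proof -
    have "\<forall>\<^sub>F t in sequentially. w t < C / 2 + 1 / 2"
      using w by (intro order_tendstoD) auto
    moreover have "\<forall>\<^sub>F t in sequentially. 1 \<le> u t"
      using u_lim by (simp add: filterlim_at_top)
    ultimately show ?thesis
    proof eventually_elim
      case (elim t)
      have "y t / u t \<le> y t" "1 / u t \<le> 1"
        using elim y_pos[of t] u_pos[of t] mult_left_mono[of 1 "u t" "y t"]
        by (simp_all add: pos_divide_le_eq)
      then have "(y t)\<^sup>2 \<le> (C + 1) + 2 * y t + 3"
        using upper[of t] elim by linarith
      moreover have "4 * y t \<le> (y t)\<^sup>2 + 4"
        using zero_le_power2[of "y t - 2"] by (simp add: power2_diff)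
      ultimately show ?case
        using y_pos[of t] C_pos by simp
    qed
  qed
  have y_mult: "(\<lambda>t. y t * z t) \<longlonglongrightarrow> 0" if "z \<longlonglongrightarrow> 0" for z
  proof (rule Lim_null_comparison)
    show "(\<lambda>t. (2 * (C + 1) + 8) * \<bar>z t\<bar>) \<longlonglongrightarrow> 0"
      using tendsto_mult_right_zero[OF tendsto_rabs_zero[OF that]] .
    show "\<forall>\<^sub>F t in sequentially. norm (y t * z t) \<le> (2 * (C + 1) + 8) * \<bar>z t\<bar>"
      using y_bdd
    proof eventually_elim
      case (elim t)
      then show ?case
        unfolding real_norm_def abs_mult by (rule mult_right_mono) simp
    qed
  qed
  have "(\<lambda>t. (y t)\<^sup>2) \<longlonglongrightarrow> C"
  proof (rule tendsto_sandwich)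
    show "\<forall>\<^sub>F t in sequentially. 2 * w t - y t * (y t * (1 / u t)) -
        2 * (y t * (sqrt (1 + u t) / u t)) - 2 * (1 / u t) \<le> (y t)\<^sup>2"
    proof (intro always_eventually allI)
      fix t
      have "(y t)\<^sup>2 * ((1 + u t) / u t) = (y t)\<^sup>2 + y t * (y t * (1 / u t))"
        using u_pos[of t] by (simp add: field_simps power2_eq_square)
      then show "2 * w t - y t * (y t * (1 / u t)) -
          2 * (y t * (sqrt (1 + u t) / u t)) - 2 * (1 / u t) \<le> (y t)\<^sup>2"
        using lower[of t] by (simp only: diff_le_eq ac_simps)
    qed
    have "(\<lambda>t. 2 * w t - y t * (y t * (1 / u t)) - 2 * (y t * (sqrt (1 + u t) / u t)) - 2 * (1 / u t))
        \<longlonglongrightarrow> 2 * (C / 2) - 0 - 2 * 0 - 2 * 0"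
      by (intro tendsto_intros w y_mult sqrt_u_ratio_lim)
    then show "(\<lambda>t. 2 * w t - y t * (y t * (1 / u t)) - 2 * (y t * (sqrt (1 + u t) / u t)) - 2 * (1 / u t))
        \<longlonglongrightarrow> C"
      by simp
    show "\<forall>\<^sub>F t in sequentially. (y t)\<^sup>2 \<le> 2 * w t + 2 * (y t / u t) + 3 * (1 / u t)"
      by (intro always_eventually allI upper)
    have "(\<lambda>t. 2 * w t + 2 * (y t * (1 / u t)) + 3 * (1 / u t)) \<longlonglongrightarrow> 2 * (C / 2) + 2 * 0 + 3 * 0"
      by (intro tendsto_intros w y_mult sqrt_u_ratio_lim)
    then show "(\<lambda>t. 2 * w t + 2 * (y t / u t) + 3 * (1 / u t)) \<longlonglongrightarrow> C"
      by simp
  qed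
  then have "(\<lambda>t. sqrt ((y t)\<^sup>2)) \<longlonglongrightarrow> sqrt C"
    by (rule tendsto_real_sqrt)
  then show ?thesis
    using y_pos by (simp add: less_imp_le)
qed

lemma risk_lim_iff:
  "\<rho> \<longlonglongrightarrow> 1 - \<beta> \<longleftrightarrow>
    s \<longlonglongrightarrow> 0 \<and> filterlim (\<lambda>t. 2 * s t * L t - ln (L t)) at_bot sequentially"
proof
  assume \<rho>: "\<rho> \<longlonglongrightarrow> 1 - \<beta>"
  note y = y_lim_if_risk_lim[OF \<rho>]
  have "(\<lambda>t. \<rho> t - (1 - normal_tail (y t))) \<longlonglongrightarrow> 1 - \<beta> - (1 - \<beta>)"
    by (intro tendsto_intros \<rho> ln_normal_tail_y_lim y)
  then have "(\<lambda>t. k t * normal_tail (c t)) \<longlonglongrightarrow> 0"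
    by (simp add: \<rho>_def)
  then show "s \<longlonglongrightarrow> 0 \<and> filterlim (\<lambda>t. 2 * s t * L t - ln (L t)) at_bot sequentially"
    using type1_term_lim_iff[OF y] y_lim_imp[OF y] by simp
next
  assume "s \<longlonglongrightarrow> 0 \<and> filterlim (\<lambda>t. 2 * s t * L t - ln (L t)) at_bot sequentially"
  then have s: "s \<longlonglongrightarrow> 0" and h: "filterlim (\<lambda>t. 2 * s t * L t - ln (L t)) at_bot sequentially"
    by auto
  note y = y_lim_if_s_lim[OF s]
  have "(\<lambda>t. k t * normal_tail (c t)) \<longlonglongrightarrow> 0"
    using type1_term_lim_iff[OF y L_lim_if_s_lim[OF s]] h by simp
  then have "(\<lambda>t. k t * normal_tail (c t) + (1 - normal_tail (y t))) \<longlonglongrightarrow> 0 + (1 - \<beta>)"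
    by (intro tendsto_intros ln_normal_tail_y_lim y)
  then show "\<rho> \<longlonglongrightarrow> 1 - \<beta>"
    by (simp add: \<rho>_def[abs_def])
qed

lemma threshold_asymp:
  assumes y: "y \<longlonglongrightarrow> sqrt C"
  shows "(\<lambda>t. (c t)\<^sup>2 - (2 * L t - ln (2 * L t) + ln (2 / (pi * \<beta>\<^sup>2)))) \<longlonglongrightarrow> 0"
proof -
  define \<mu> where "\<mu> t = - ln (normal_tail (c t)) - (c t)\<^sup>2 / 2 - ln (c t)" for t
  have \<mu>: "\<mu> \<longlonglongrightarrow> ln (pi / 2) / 2"
    unfolding \<mu>_def by (rule filterlim_compose[OF minus_ln_normal_tail_asymp y_lim_imp(3)[OF y]])
  have "(\<lambda>t. (y t)\<^sup>2 * ((1 + u t) / u t) / (2 * (L t / u t))) \<longlonglongrightarrow> (sqrt C)\<^sup>2 * 1 / (2 * (C / 2))"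
    using C_pos by (intro tendsto_intros y sqrt_u_ratio_lim y_lim_imp(1)[OF y]) auto
  moreover have "(y t)\<^sup>2 * ((1 + u t) / u t) / (2 * (L t / u t)) = (c t)\<^sup>2 / (2 * L t)" for t
    using u_pos[of t] by (simp add: c_sq)
  ultimately have "(\<lambda>t. (c t)\<^sup>2 / (2 * L t)) \<longlonglongrightarrow> (sqrt C)\<^sup>2 * 1 / (2 * (C / 2))"
    by (simp only:)
  then have "(\<lambda>t. (c t)\<^sup>2 / (2 * L t)) \<longlonglongrightarrow> 1"
    using C_pos by simp
  then have "(\<lambda>t. ln ((c t)\<^sup>2 / (2 * L t))) \<longlonglongrightarrow> ln 1"
    by (intro tendsto_ln) auto
  then have "(\<lambda>t. 2 * ln (normal_tail (y t)) * (-1) - 2 * \<mu> t - ln ((c t)\<^sup>2 / (2 * L t)) - ln (2 / (pi * \<beta>\<^sup>2)))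
      \<longlonglongrightarrow> 2 * ln \<beta> * (-1) - 2 * (ln (pi / 2) / 2) - ln 1 - ln (2 / (pi * \<beta>\<^sup>2))"
    by (intro tendsto_diff tendsto_mult_left tendsto_mult_right tendsto_const ln_normal_tail_y_lim y \<mu>)
  also have "2 * ln \<beta> * (-1) - 2 * (ln (pi / 2) / 2) - ln 1 - ln (2 / (pi * \<beta>\<^sup>2)) = 0"
    using \<beta>_pos by (simp add: ln_div ln_mult ln_realpow)
  also have "(\<lambda>t. 2 * ln (normal_tail (y t)) * (-1) - 2 * \<mu> t - ln ((c t)\<^sup>2 / (2 * L t)) - ln (2 / (pi * \<beta>\<^sup>2)))
      = (\<lambda>t. (c t)\<^sup>2 - (2 * L t - ln (2 * L t) + ln (2 / (pi * \<beta>\<^sup>2))))"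
  proof
    fix t
    have "ln ((c t)\<^sup>2 / (2 * L t)) = 2 * ln (c t) - ln (2 * L t)"
      using c_pos[of t] L_pos[of t] by (simp add: ln_div ln_realpow)
    then show "2 * ln (normal_tail (y t)) * (-1) - 2 * \<mu> t - ln ((c t)\<^sup>2 / (2 * L t)) - ln (2 / (pi * \<beta>\<^sup>2))
      = (c t)\<^sup>2 - (2 * L t - ln (2 * L t) + ln (2 / (pi * \<beta>\<^sup>2)))"
      using bfdr[of t] by (simp add: \<mu>_def y_def[symmetric] algebra_simps)
  qed
  finally show ?thesis .
qed

text \<open>
  The bounds of \<open>optimal_risk_bounds\<close>, normalised: the second sequence is the risk of the rule with
  threshold \<open>sqrt (ln v)\<close>.
\<close>

lemma oracle_risk_bounds_lim:
  shows "(\<lambda>t. 1 - normal_tail (sqrt (ln (v t)) / sqrt (1 + u t))) \<longlonglongrightarrow> 1 - \<beta>"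
    and "(\<lambda>t. k t * normal_tail (sqrt (ln (v t))) +
      (1 - normal_tail (sqrt (ln (v t)) / sqrt (1 + u t)))) \<longlonglongrightarrow> 1 - \<beta>"
proof -
  have "(\<lambda>t. sqrt ((ln (v t) / u t) / ((1 + u t) / u t))) \<longlonglongrightarrow> sqrt (C / 1)"
    by (intro tendsto_real_sqrt tendsto_divide C_lim sqrt_u_ratio_lim) auto
  moreover have "sqrt ((ln (v t) / u t) / ((1 + u t) / u t)) = sqrt (ln (v t)) / sqrt (1 + u t)" for t
    using u_pos[of t] by (simp add: real_sqrt_divide)
  ultimately have "(\<lambda>t. sqrt (ln (v t)) / sqrt (1 + u t)) \<longlonglongrightarrow> sqrt C"
    by simp
  from isCont_tendsto_compose[OF isCont_normal_tail this]
  show 1: "(\<lambda>t. 1 - normal_tail (sqrt (ln (v t)) / sqrt (1 + u t))) \<longlonglongrightarrow> 1 - \<beta>"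
    unfolding \<beta>_def by (rule tendsto_diff[OF tendsto_const])
  have "(\<lambda>t. k t * normal_tail (sqrt (ln (v t)))) \<longlonglongrightarrow> 0"
  proof (rule tendsto_sandwich)
    show "\<forall>\<^sub>F t in sequentially. 0 \<le> k t * normal_tail (sqrt (ln (v t)))"
      by (intro always_eventually allI mult_nonneg_nonneg normal_tail_nonneg less_imp_le[OF k_pos])
    have "\<forall>\<^sub>F t in sequentially. 0 < ln (v t) / u t"
      using C_lim C_pos by (intro order_tendstoD) auto
    then show "\<forall>\<^sub>F t in sequentially. k t * normal_tail (sqrt (ln (v t))) \<le> exp (1 / 2 - ln (u t) / 2)"
    proof eventually_elim
      case (elim t)
      then have ln_v: "0 < ln (v t)"
        using u_pos[of t] by (simp add: zero_less_divide_iff)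
      then have pos: "0 < normal_tail (sqrt (ln (v t)))"
        by (intro normal_tail_pos) auto
      have "ln (k t * normal_tail (sqrt (ln (v t)))) \<le> 1 / 2 - ln (u t) / 2"
        using minus_ln_normal_tail_ge[of "sqrt (ln (v t))"] ln_v k_pos[of t] pos
        by (simp add: ln_mult ln_k)
      then have "exp (ln (k t * normal_tail (sqrt (ln (v t))))) \<le> exp (1 / 2 - ln (u t) / 2)"
        by simp
      then show ?case
        using k_pos[of t] pos by simp
    qed
    show "(\<lambda>t. exp (1 / 2 - ln (u t) / 2)) \<longlonglongrightarrow> 0"
      by (rule filterlim_compose[OF _ u_lim]) real_asymp
  qed simp
  from tendsto_add[OF this 1]
  show "(\<lambda>t. k t * normal_tail (sqrt (ln (v t))) +
      (1 - normal_tail (sqrt (ln (v t)) / sqrt (1 + u t)))) \<longlonglongrightarrow> 1 - \<beta>"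
    by simp
qed

end

section \<open>Characterisation of asymptotic Bayes optimality\<close>

lemma (in two_groups) normalised_bayes_risk_fixed_threshold:
  assumes "0 < c" "0 < \<delta>0" "0 < \<delta>A"
  shows "bayes_risk M m \<delta>0 \<delta>A \<nu> X (fixed_threshold_rule \<sigma>2 c) =
    real m * (\<delta>A * p) * ((1 - p) / p * (\<delta>0 / \<delta>A) * normal_tail c +
      (1 - normal_tail (c / sqrt (1 + \<tau>2 / \<sigma>2))))"
  using assms p_pos by (simp add: bayes_risk_fixed_threshold field_simps)

theorem theorem4p1:
  fixes M :: "nat \<Rightarrow> 'w measure" and m :: "nat \<Rightarrow> nat"
    and p \<sigma>2 \<tau>2 \<delta>0 \<delta>A \<alpha> :: "nat \<Rightarrow> real"
    and \<nu> :: "nat \<Rightarrow> nat \<Rightarrow> 'w \<Rightarrow> bool" and X :: "nat \<Rightarrow> nat \<Rightarrow> 'w \<Rightarrow> real"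
    and u f \<delta> v r s c\<^sub>B :: "nat \<Rightarrow> real" and \<phi>\<^sub>B :: "nat \<Rightarrow> testing_rule"
    and C C\<^sub>1 D :: real
  assumes m: "\<And>t. m t \<ge> 1"
    and p: "\<And>t. 0 < p t" "\<And>t. p t < 1"
    and \<sigma>2: "\<And>t. 0 < \<sigma>2 t"
    and \<tau>2: "\<And>t. 0 < \<tau>2 t"
    and \<delta>0: "\<And>t. 0 < \<delta>0 t"
    and \<delta>A: "\<And>t. 0 < \<delta>A t"
    and model: "\<And>t. two_groups_model (M t) (m t) (p t) (\<sigma>2 t) (\<tau>2 t) (\<nu> t) (X t)"
    and u: "\<And>t. u t = \<tau>2 t / \<sigma>2 t"
    and f: "\<And>t. f t = (1 - p t) / p t"
    and \<delta>: "\<And>t. \<delta> t = \<delta>0 t / \<delta>A t"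
    and v: "\<And>t. v t = u t * (f t)\<^sup>2 * (\<delta> t)\<^sup>2"
    and p_lim: "p \<longlonglongrightarrow> 0"
    and u_lim: "filterlim u at_top sequentially"
    and v_lim: "filterlim v at_top sequentially"
    and C: "0 < C"
    and C_lim: "(\<lambda>t. ln (v t) / u t) \<longlonglongrightarrow> C"
    and \<alpha>: "\<And>t. 0 < \<alpha> t" "\<And>t. \<alpha> t < 1 - p t"
    and c\<^sub>B: "\<And>t. 0 < c\<^sub>B t"
    and \<phi>\<^sub>B: "\<And>t. \<phi>\<^sub>B t = fixed_threshold_rule (\<sigma>2 t) (c\<^sub>B t)"
    and BFDR: "\<And>t i. i \<in> {1..m t} \<Longrightarrow> BFDR (M t) (m t) (\<nu> t) (X t) (\<phi>\<^sub>B t) i = \<alpha> t"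
    and r: "\<And>t. r t = \<alpha> t / (1 - \<alpha> t)"
    and s: "\<And>t. ln (f t * \<delta> t * sqrt (u t)) / ln (f t / r t) = 1 + s t"
    and D: "D = 2 * (1 - std_normal_cdf (sqrt C))"
    and C\<^sub>1: "C\<^sub>1 = ln (2 / (pi * D\<^sup>2))"
  shows "(ABOS M m \<delta>0 \<delta>A \<nu> X \<phi>\<^sub>B \<longleftrightarrow>
            s \<longlonglongrightarrow> 0 \<and>
            filterlim (\<lambda>t. 2 * s t * ln (f t / r t) - ln (ln (f t / r t))) at_bot sequentially) \<and>
         (ABOS M m \<delta>0 \<delta>A \<nu> X \<phi>\<^sub>B \<longrightarrow>
            (\<exists>\<epsilon>. \<epsilon> \<longlonglongrightarrow> 0 \<and>
               (\<forall>t. (c\<^sub>B t)\<^sup>2 = 2 * ln (f t / r t) - ln (2 * ln (f t / r t)) + C\<^sub>1 + \<epsilon> t)) \<and>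
            (\<exists>\<epsilon>. \<epsilon> \<longlonglongrightarrow> 0 \<and>
               (\<forall>t. \<forall>i\<in>{1..m t}.
                  type1_error_prob (M t) (m t) (\<nu> t) (X t) (\<phi>\<^sub>B t) i = D * (r t / f t) * (1 + \<epsilon> t))))"
proof -
  have tg: "two_groups (M t) (m t) (p t) (\<sigma>2 t) (\<tau>2 t) (\<nu> t) (X t)" for t
    using model[of t] p[of t] \<sigma>2[of t] \<tau>2[of t]
    by (auto simp: two_groups_def two_groups_axioms_def two_groups_model_def)
  have u_pos: "0 < u t" and f_pos: "0 < f t" and \<delta>_pos: "0 < \<delta> t" for t
    using \<sigma>2[of t] \<tau>2[of t] p[of t] \<delta>0[of t] \<delta>A[of t] by (auto simp: u f \<delta>)
  have v_pos: "0 < v t" for t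
    using u_pos[of t] f_pos[of t] \<delta>_pos[of t] by (simp add: v)
  have \<alpha>_less: "\<alpha> t < 1" for t
    using \<alpha>(2)[of t] p(1)[of t] by simp
  have r_pos: "0 < r t" for t
    using \<alpha>(1)[of t] \<alpha>_less[of t] by (simp add: r)
  have r_less: "r t < f t" for t
    using \<alpha>[of t] \<alpha>_less[of t] p[of t] by (simp add: r f field_simps)
  define L where "L t = ln (f t / r t)" for t
  have L_pos: "0 < L t" for t
    using r_pos[of t] r_less[of t] by (simp add: L_def)
  have i1: "1 \<in> {1..m t}" for t
    using m[of t] by simp

  have tail_eq: "r t * normal_tail (c\<^sub>B t / sqrt (1 + u t)) = f t * normal_tail (c\<^sub>B t)" for t
  proof -
    define a b where "a = normal_tail (c\<^sub>B t)" and "b = normal_tail (c\<^sub>B t / sqrt (1 + u t))"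
    have pos: "0 < a" "0 < b"
      unfolding a_def b_def using c\<^sub>B[of t] u_pos[of t] by (auto intro!: normal_tail_pos)
    have "\<alpha> t = (1 - p t) * a / ((1 - p t) * a + p t * b)"
      using two_groups.BFDR_fixed_threshold[OF tg[of t] i1 c\<^sub>B[of t]] BFDR[OF i1, of t]
      by (simp add: \<phi>\<^sub>B a_def b_def u)
    moreover have "0 < (1 - p t) * a + p t * b"
      using pos p[of t] by (intro add_pos_pos mult_pos_pos) auto
    ultimately have "\<alpha> t * ((1 - p t) * a + p t * b) = (1 - p t) * a"
      by simp
    then have "\<alpha> t * (p t * b) = (1 - \<alpha> t) * ((1 - p t) * a)"
      by (simp add: algebra_simps)
    then have "r t * b = f t * a"
      using p[of t] \<alpha>_less[of t] by (simp add: r f field_simps)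
    then show ?thesis
      by (simp add: a_def b_def)
  qed
  have ln_v: "ln (v t) / 2 = ln (f t * \<delta> t * sqrt (u t))" for t
    using u_pos[of t] f_pos[of t] \<delta>_pos[of t] by (simp add: v ln_mult ln_sqrt ln_realpow)

  interpret bfdr_threshold_asymptotics u v L s c\<^sub>B C
  proof
    fix t
    show "ln (normal_tail (c\<^sub>B t / sqrt (1 + u t))) - ln (normal_tail (c\<^sub>B t)) = L t"
    proof -
      have pos: "0 < normal_tail (c\<^sub>B t)" "0 < normal_tail (c\<^sub>B t / sqrt (1 + u t))"
        using c\<^sub>B[of t] u_pos[of t] by (auto intro!: normal_tail_pos)
      have "ln (r t) + ln (normal_tail (c\<^sub>B t / sqrt (1 + u t))) = ln (f t) + ln (normal_tail (c\<^sub>B t))"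
        using arg_cong[OF tail_eq[of t], of ln] pos r_pos[of t] f_pos[of t] by (simp add: ln_mult)
      then show ?thesis
        using r_pos[of t] f_pos[of t] by (simp add: L_def ln_div)
    qed
    show "ln (v t) / 2 / L t = 1 + s t"
      unfolding ln_v L_def by (rule s)
  qed (fact u_pos v_pos c\<^sub>B L_pos u_lim C C_lim)+

  have D_eq: "D = \<beta>"
    by (simp add: D \<beta>_def normal_tail_def)
  have k_eq: "k t = f t * \<delta> t" for t
    using u_pos[of t] f_pos[of t] \<delta>_pos[of t]
    by (simp add: k_def v real_sqrt_mult)
  \<comment> \<open>The common normalisation of all risks, \<open>m * p * \<delta>A\<close>.\<close>
  define \<kappa> where "\<kappa> t = real (m t) * (\<delta>A t * p t)" for t
  have \<kappa>_pos: "0 < \<kappa> t" for t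
    using m[of t] \<delta>A[of t] p[of t] by (simp add: \<kappa>_def)
  let ?opt = "\<lambda>t. optimal_risk (M t) (m t) (\<delta>0 t) (\<delta>A t) (\<nu> t) (X t)"
  have risk: "bayes_risk (M t) (m t) (\<delta>0 t) (\<delta>A t) (\<nu> t) (X t) (fixed_threshold_rule (\<sigma>2 t) c) =
      \<kappa> t * (k t * normal_tail c + (1 - normal_tail (c / sqrt (1 + u t))))" if "0 < c" for t c
    using two_groups.normalised_bayes_risk_fixed_threshold[OF tg that \<delta>0 \<delta>A]
    by (simp add: \<kappa>_def k_eq f \<delta> u)
  have opt_lim: "(\<lambda>t. ?opt t / \<kappa> t) \<longlonglongrightarrow> 1 - D"
    unfolding D_eq
  proof (rule tendsto_sandwich)
    have ev: "\<forall>\<^sub>F t in sequentially. 1 < v t"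
      using v_lim by (simp add: filterlim_at_top_dense)
    have cond: "\<delta>A t * p t * sqrt (v t) \<le> \<delta>0 t * (1 - p t) * sqrt (1 + \<tau>2 t / \<sigma>2 t)" for t
    proof -
      have "\<delta>A t * p t * sqrt (v t) = \<delta>A t * p t * (f t * \<delta> t) * sqrt (u t)"
        using u_pos[of t] f_pos[of t] \<delta>_pos[of t] by (simp add: v real_sqrt_mult)
      also have "\<delta>A t * p t * (f t * \<delta> t) = \<delta>0 t * (1 - p t)"
        using p[of t] \<delta>A[of t] by (simp add: f \<delta>)
      also have "\<delta>0 t * (1 - p t) * sqrt (u t) \<le> \<delta>0 t * (1 - p t) * sqrt (1 + \<tau>2 t / \<sigma>2 t)"
        using p[of t] \<delta>0[of t] by (intro mult_left_mono) (auto simp: u)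
      finally show ?thesis .
    qed
    show "\<forall>\<^sub>F t in sequentially. 1 - normal_tail (sqrt (ln (v t)) / sqrt (1 + u t)) \<le> ?opt t / \<kappa> t"
      using ev
    proof eventually_elim
      case (elim t)
      have "\<kappa> t * (1 - normal_tail (sqrt (ln (v t)) / sqrt (1 + u t))) \<le> ?opt t"
        using two_groups.optimal_risk_bounds(1)[OF tg less_imp_le[OF \<delta>0] less_imp_le[OF \<delta>A] elim cond]
        by (simp add: \<kappa>_def u mult.assoc)
      then show ?case
        using \<kappa>_pos[of t] by (simp add: pos_le_divide_eq mult.commute)
    qed
    show "\<forall>\<^sub>F t in sequentially. ?opt t / \<kappa> t \<le>
        k t * normal_tail (sqrt (ln (v t))) + (1 - normal_tail (sqrt (ln (v t)) / sqrt (1 + u t)))"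
      using ev
    proof eventually_elim
      case (elim t)
      have "?opt t \<le> \<kappa> t * (k t * normal_tail (sqrt (ln (v t))) +
          (1 - normal_tail (sqrt (ln (v t)) / sqrt (1 + u t))))"
        using two_groups.optimal_risk_bounds(2)[OF tg less_imp_le[OF \<delta>0] less_imp_le[OF \<delta>A] elim cond
            fixed_threshold_rule_in_testing_rules[of "\<sigma>2 t" "sqrt (ln (v t))"]] elim
        by (simp add: risk)
      then show ?case
        using \<kappa>_pos[of t] by (simp add: pos_divide_le_eq mult.commute)
    qed
  qed (fact oracle_risk_bounds_lim)+
  have D_less: "D < 1"
    unfolding D_eq \<beta>_def using C by (intro normal_tail_less_1) simp

  let ?R = "\<lambda>t. bayes_risk (M t) (m t) (\<delta>0 t) (\<delta>A t) (\<nu> t) (X t) (\<phi>\<^sub>B t)"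
  have R_eq: "?R t / \<kappa> t = \<rho> t" for t
    using risk[OF c\<^sub>B, of t t] \<kappa>_pos[of t] by (simp add: \<phi>\<^sub>B \<rho>_def y_def)
  have "ABOS M m \<delta>0 \<delta>A \<nu> X \<phi>\<^sub>B \<longleftrightarrow> \<rho> \<longlonglongrightarrow> 1 - D"
  proof
    assume "ABOS M m \<delta>0 \<delta>A \<nu> X \<phi>\<^sub>B"
    then have "(\<lambda>t. ?R t / ?opt t * (?opt t / \<kappa> t)) \<longlonglongrightarrow> 1 * (1 - D)"
      unfolding ABOS_def by (intro tendsto_mult opt_lim)
    moreover have "\<forall>\<^sub>F t in sequentially. 0 < ?opt t / \<kappa> t"
      using opt_lim D_less by (intro order_tendstoD) auto
    then have "\<forall>\<^sub>F t in sequentially. ?R t / ?opt t * (?opt t / \<kappa> t) = \<rho> t"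
      by eventually_elim (auto simp: R_eq[symmetric])
    ultimately show "\<rho> \<longlonglongrightarrow> 1 - D"
      by (simp add: tendsto_cong)
  next
    assume "\<rho> \<longlonglongrightarrow> 1 - D"
    then have "(\<lambda>t. \<rho> t / (?opt t / \<kappa> t)) \<longlonglongrightarrow> (1 - D) / (1 - D)"
      using D_less by (intro tendsto_divide opt_lim) auto
    moreover have "\<rho> t / (?opt t / \<kappa> t) = ?R t / ?opt t" for t
      using \<kappa>_pos[of t] by (simp add: R_eq[symmetric])
    ultimately have "(\<lambda>t. ?R t / ?opt t) \<longlonglongrightarrow> (1 - D) / (1 - D)"
      by (simp only:)
    then show "ABOS M m \<delta>0 \<delta>A \<nu> X \<phi>\<^sub>B"
      using D_less by (simp add: ABOS_def)
  qed
  note ABOS_iff = this[unfolded D_eq]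

  have thresholds: "(\<exists>\<epsilon>. \<epsilon> \<longlonglongrightarrow> 0 \<and>
      (\<forall>t. (c\<^sub>B t)\<^sup>2 = 2 * ln (f t / r t) - ln (2 * ln (f t / r t)) + C\<^sub>1 + \<epsilon> t)) \<and>
    (\<exists>\<epsilon>. \<epsilon> \<longlonglongrightarrow> 0 \<and> (\<forall>t. \<forall>i\<in>{1..m t}.
      type1_error_prob (M t) (m t) (\<nu> t) (X t) (\<phi>\<^sub>B t) i = D * (r t / f t) * (1 + \<epsilon> t)))"
    if "ABOS M m \<delta>0 \<delta>A \<nu> X \<phi>\<^sub>B"
  proof
    have y: "y \<longlonglongrightarrow> sqrt C"
      using that ABOS_iff by (intro y_lim_if_risk_lim) simp
    show "\<exists>\<epsilon>. \<epsilon> \<longlonglongrightarrow> 0 \<and>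
      (\<forall>t. (c\<^sub>B t)\<^sup>2 = 2 * ln (f t / r t) - ln (2 * ln (f t / r t)) + C\<^sub>1 + \<epsilon> t)"
      using threshold_asymp[OF y] unfolding C\<^sub>1 D_eq L_def
      by (intro exI conjI allI) (assumption, simp)
    have "(\<lambda>t. normal_tail (y t) / D - 1) \<longlonglongrightarrow> D / D - 1"
      unfolding D_eq using \<beta>_pos
      by (intro tendsto_diff tendsto_divide tendsto_const ln_normal_tail_y_lim y) auto
    moreover have "0 < D"
      unfolding D_eq by (rule \<beta>_pos)
    ultimately have "(\<lambda>t. normal_tail (y t) / D - 1) \<longlonglongrightarrow> 0"
      by simp
    moreover have "type1_error_prob (M t) (m t) (\<nu> t) (X t) (\<phi>\<^sub>B t) i =
        D * (r t / f t) * (1 + (normal_tail (y t) / D - 1))" if "i \<in> {1..m t}" for t i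
      using two_groups.type1_error_prob_fixed_threshold[OF tg that c\<^sub>B[of t]] tail_eq[of t]
        f_pos[of t] \<open>0 < D\<close> by (simp add: \<phi>\<^sub>B y_def field_simps)
    ultimately show "\<exists>\<epsilon>. \<epsilon> \<longlonglongrightarrow> 0 \<and> (\<forall>t. \<forall>i\<in>{1..m t}.
      type1_error_prob (M t) (m t) (\<nu> t) (X t) (\<phi>\<^sub>B t) i = D * (r t / f t) * (1 + \<epsilon> t))"
      by blast
  qed
  show ?thesis
    using ABOS_iff risk_lim_iff thresholds unfolding L_def by blast
qed

end
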